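(* Let $(\mathcal{A},\mathcal{E})$ be an exact category and $\mathcal{X}$ an additive subcategory of $\mathcal{A}$. Assume that for each object $A$ of $\mathcal{A}$ there are conflations $X_1\to X_0\xrightarrow{p}A$ and $A\xrightarrow{i}X^0\to X^1$ in $\mathcal{E}$ such that $p$ is an $\mathcal{X}$-precover, $i$ is an $\mathcal{X}$-preenvelope and $X_1,X^1\in\mathcal{X}$. Then $\mathcal{A}/\mathcal{X}$ is a preabelian category (every morphism has a kernel and a cokernel), and it has an exact structure induced by $\mathcal{X}$-complete conflations; that is, the class of sequences in $\mathcal{A}/\mathcal{X}$ isomorphic to images $A\xrightarrow{\underline{f}}B\xrightarrow{\underline{g}}C$ of $\mathcal{X}$-complete conflations $A\xrightarrow{f}B\xrightarrow{g}C$ is an exact structure on $\mathcal{A}/\mathcal{X}$.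
   Context: All subcategories are full and closed under isomorphisms. "Exact category" is in the sense of Quillen/Keller: $\mathcal{E}$ is a class of kernel-cokernel sequences (conflations) closed under isomorphisms satisfying the usual axioms; in a conflation $A\xrightarrow{i}B\xrightarrow{d}C$, $i$ is an inflation and $d$ a deflation. A morphism $f:A\to B$ is $\mathcal{X}$-monic if $\mathrm{Hom}(B,X)\to\mathrm{Hom}(A,X)$ is surjective for all $X\in\mathcal{X}$, and $\mathcal{X}$-epic if $\mathrm{Hom}(X,A)\to\mathrm{Hom}(X,B)$ is surjective for all $X\in\mathcal{X}$. An $\mathcal{X}$-preenvelope is an $\mathcal{X}$-monic $A\to X$ with $X\in\mathcal{X}$; an $\mathcal{X}$-precover is an $\mathcal{X}$-epic $X\to A$ with $X\in\mathcal{X}$. A conflation $A\xrightarrow{f}B\xrightarrow{g}C$ is $\mathcal{X}$-complete if $f$ is $\mathcal{X}$-monic and $g$ is $\mathcal{X}$-epic. $\mathcal{A}/\mathcal{X}$ has the objects of $\mathcal{A}$, and its morphisms are classes $\underline{f}$ of morphisms of $\mathcal{A}$, where $f,f'$ are identified iff $f-f'$ factors through an object of $\mathcal{X}$. *)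

theory Defs
  imports "HOL-Algebra.Coset"
begin

(* Every Hom C A B is a group record whose (commutative) multiplication is the addition of
   morphisms A -> B; so "inv" is negation and \<one> is the zero morphism.
   Composition is indexed by the three objects involved, so that hom-sets need not be disjoint:
   Cmp C A B D g f is the composite of f : A -> B and g : B -> D. *)
record ('o, 'm) cat =
  Obj :: "'o set"
  Hom :: "'o \<Rightarrow> 'o \<Rightarrow> 'm monoid"
  Cmp :: "'o \<Rightarrow> 'o \<Rightarrow> 'o \<Rightarrow> 'm \<Rightarrow> 'm \<Rightarrow> 'm"
  Idm :: "'o \<Rightarrow> 'm"

abbreviation mor :: "('o, 'm) cat \<Rightarrow> 'o \<Rightarrow> 'o \<Rightarrow> 'm set" where
  "mor C A B \<equiv> carrier (Hom C A B)"

abbreviation zero_mor :: "('o, 'm) cat \<Rightarrow> 'o \<Rightarrow> 'o \<Rightarrow> 'm" where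
  "zero_mor C A B \<equiv> \<one>\<^bsub>Hom C A B\<^esub>"

locale preadditive_category =
  fixes C :: "('o, 'm) cat"
  assumes comp_closed:
      "\<lbrakk>A \<in> Obj C; B \<in> Obj C; D \<in> Obj C; f \<in> mor C A B; g \<in> mor C B D\<rbrakk>
        \<Longrightarrow> Cmp C A B D g f \<in> mor C A D"
    and comp_assoc:
      "\<lbrakk>A \<in> Obj C; B \<in> Obj C; D \<in> Obj C; F \<in> Obj C;
        f \<in> mor C A B; g \<in> mor C B D; h \<in> mor C D F\<rbrakk>
        \<Longrightarrow> Cmp C A D F h (Cmp C A B D g f) = Cmp C A B F (Cmp C B D F h g) f"
    and id_closed: "A \<in> Obj C \<Longrightarrow> Idm C A \<in> mor C A A"
    and comp_id_left:
      "\<lbrakk>A \<in> Obj C; B \<in> Obj C; f \<in> mor C A B\<rbrakk> \<Longrightarrow> Cmp C A B B (Idm C B) f = f"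
    and comp_id_right:
      "\<lbrakk>A \<in> Obj C; B \<in> Obj C; f \<in> mor C A B\<rbrakk> \<Longrightarrow> Cmp C A A B f (Idm C A) = f"
    and hom_comm_group: "\<lbrakk>A \<in> Obj C; B \<in> Obj C\<rbrakk> \<Longrightarrow> comm_group (Hom C A B)"
    and comp_add_left:
      "\<lbrakk>A \<in> Obj C; B \<in> Obj C; D \<in> Obj C; f \<in> mor C A B; g \<in> mor C B D; g' \<in> mor C B D\<rbrakk>
        \<Longrightarrow> Cmp C A B D (g \<otimes>\<^bsub>Hom C B D\<^esub> g') f
            = Cmp C A B D g f \<otimes>\<^bsub>Hom C A D\<^esub> Cmp C A B D g' f"
    and comp_add_right:
      "\<lbrakk>A \<in> Obj C; B \<in> Obj C; D \<in> Obj C; f \<in> mor C A B; f' \<in> mor C A B; g \<in> mor C B D\<rbrakk>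
        \<Longrightarrow> Cmp C A B D g (f \<otimes>\<^bsub>Hom C A B\<^esub> f')
            = Cmp C A B D g f \<otimes>\<^bsub>Hom C A D\<^esub> Cmp C A B D g f'"

definition is_zero_object :: "('o, 'm) cat \<Rightarrow> 'o \<Rightarrow> bool" where
  "is_zero_object C Z \<longleftrightarrow> Z \<in> Obj C \<and>
     (\<forall>A \<in> Obj C. (\<exists>!f. f \<in> mor C Z A) \<and> (\<exists>!f. f \<in> mor C A Z))"

(* S is the biproduct of A and B with injections i, j and projections p, q *)
definition is_biproduct ::
  "('o, 'm) cat \<Rightarrow> 'o \<Rightarrow> 'o \<Rightarrow> 'o \<Rightarrow> 'm \<Rightarrow> 'm \<Rightarrow> 'm \<Rightarrow> 'm \<Rightarrow> bool" where
  "is_biproduct C A B S i j p q \<longleftrightarrow>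
     A \<in> Obj C \<and> B \<in> Obj C \<and> S \<in> Obj C \<and>
     i \<in> mor C A S \<and> j \<in> mor C B S \<and> p \<in> mor C S A \<and> q \<in> mor C S B \<and>
     Cmp C A S A p i = Idm C A \<and> Cmp C B S B q j = Idm C B \<and>
     Cmp C B S A p j = zero_mor C B A \<and> Cmp C A S B q i = zero_mor C A B \<and>
     Cmp C S A S i p \<otimes>\<^bsub>Hom C S S\<^esub> Cmp C S B S j q = Idm C S"

locale additive_category = preadditive_category C for C :: "('o, 'm) cat" +
  assumes ex_zero_object: "\<exists>Z. is_zero_object C Z"
    and ex_biproduct:
      "\<lbrakk>A \<in> Obj C; B \<in> Obj C\<rbrakk> \<Longrightarrow> \<exists>S i j p q. is_biproduct C A B S i j p q"

definition is_iso :: "('o, 'm) cat \<Rightarrow> 'o \<Rightarrow> 'o \<Rightarrow> 'm \<Rightarrow> bool" where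
  "is_iso C A B f \<longleftrightarrow> A \<in> Obj C \<and> B \<in> Obj C \<and> f \<in> mor C A B \<and>
     (\<exists>g \<in> mor C B A. Cmp C A B A g f = Idm C A \<and> Cmp C B A B f g = Idm C B)"

(* k : K -> A is a kernel of f : A -> B *)
definition is_kernel :: "('o, 'm) cat \<Rightarrow> 'o \<Rightarrow> 'o \<Rightarrow> 'o \<Rightarrow> 'm \<Rightarrow> 'm \<Rightarrow> bool" where
  "is_kernel C K A B k f \<longleftrightarrow>
     K \<in> Obj C \<and> A \<in> Obj C \<and> B \<in> Obj C \<and> k \<in> mor C K A \<and> f \<in> mor C A B \<and>
     Cmp C K A B f k = zero_mor C K B \<and>
     (\<forall>T \<in> Obj C. \<forall>t \<in> mor C T A. Cmp C T A B f t = zero_mor C T B \<longrightarrow>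
        (\<exists>!u. u \<in> mor C T K \<and> Cmp C T K A k u = t))"

(* c : B -> Q is a cokernel of f : A -> B *)
definition is_cokernel :: "('o, 'm) cat \<Rightarrow> 'o \<Rightarrow> 'o \<Rightarrow> 'o \<Rightarrow> 'm \<Rightarrow> 'm \<Rightarrow> bool" where
  "is_cokernel C A B Q f c \<longleftrightarrow>
     A \<in> Obj C \<and> B \<in> Obj C \<and> Q \<in> Obj C \<and> f \<in> mor C A B \<and> c \<in> mor C B Q \<and>
     Cmp C A B Q c f = zero_mor C A Q \<and>
     (\<forall>T \<in> Obj C. \<forall>t \<in> mor C B T. Cmp C A B T t f = zero_mor C A T \<longrightarrow>
        (\<exists>!u. u \<in> mor C Q T \<and> Cmp C B Q T u c = t))"

locale preabelian_category = additive_category C for C :: "('o, 'm) cat" +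
  assumes ex_kernel:
      "\<lbrakk>A \<in> Obj C; B \<in> Obj C; f \<in> mor C A B\<rbrakk> \<Longrightarrow> \<exists>K k. is_kernel C K A B k f"
    and ex_cokernel:
      "\<lbrakk>A \<in> Obj C; B \<in> Obj C; f \<in> mor C A B\<rbrakk> \<Longrightarrow> \<exists>Q c. is_cokernel C A B Q f c"

(* the square with sides p : P -> A, q : P -> B and f : A -> D, g : B -> D is cartesian *)
definition is_pullback ::
  "('o, 'm) cat \<Rightarrow> 'o \<Rightarrow> 'o \<Rightarrow> 'o \<Rightarrow> 'o \<Rightarrow> 'm \<Rightarrow> 'm \<Rightarrow> 'm \<Rightarrow> 'm \<Rightarrow> bool" where
  "is_pullback C P A B D p q f g \<longleftrightarrow>
     P \<in> Obj C \<and> A \<in> Obj C \<and> B \<in> Obj C \<and> D \<in> Obj C \<and>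
     p \<in> mor C P A \<and> q \<in> mor C P B \<and> f \<in> mor C A D \<and> g \<in> mor C B D \<and>
     Cmp C P A D f p = Cmp C P B D g q \<and>
     (\<forall>T \<in> Obj C. \<forall>s \<in> mor C T A. \<forall>t \<in> mor C T B. Cmp C T A D f s = Cmp C T B D g t \<longrightarrow>
        (\<exists>!u. u \<in> mor C T P \<and> Cmp C T P A p u = s \<and> Cmp C T P B q u = t))"

(* the square with sides f : D -> A, g : D -> B and p : A -> P, q : B -> P is cocartesian *)
definition is_pushout ::
  "('o, 'm) cat \<Rightarrow> 'o \<Rightarrow> 'o \<Rightarrow> 'o \<Rightarrow> 'o \<Rightarrow> 'm \<Rightarrow> 'm \<Rightarrow> 'm \<Rightarrow> 'm \<Rightarrow> bool" where
  "is_pushout C D A B P f g p q \<longleftrightarrow>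
     P \<in> Obj C \<and> A \<in> Obj C \<and> B \<in> Obj C \<and> D \<in> Obj C \<and>
     f \<in> mor C D A \<and> g \<in> mor C D B \<and> p \<in> mor C A P \<and> q \<in> mor C B P \<and>
     Cmp C D A P p f = Cmp C D B P q g \<and>
     (\<forall>T \<in> Obj C. \<forall>s \<in> mor C A T. \<forall>t \<in> mor C B T. Cmp C D A T s f = Cmp C D B T t g \<longrightarrow>
        (\<exists>!u. u \<in> mor C P T \<and> Cmp C A P T u p = s \<and> Cmp C B P T u q = t))"

(* (A, f, B, g, D) stands for the sequence A -f-> B -g-> D *)
type_synonym ('o, 'm) short_seq = "'o \<times> 'm \<times> 'o \<times> 'm \<times> 'o"

definition kernel_cokernel_pairs :: "('o, 'm) cat \<Rightarrow> ('o, 'm) short_seq set" where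
  "kernel_cokernel_pairs C =
     {(A, f, B, g, D). is_kernel C A B D f g \<and> is_cokernel C A B D f g}"

definition seq_isomorphic ::
  "('o, 'm) cat \<Rightarrow> ('o, 'm) short_seq \<Rightarrow> ('o, 'm) short_seq \<Rightarrow> bool" where
  "seq_isomorphic C = (\<lambda>(A, f, B, g, D) (A', f', B', g', D').
     f \<in> mor C A B \<and> g \<in> mor C B D \<and> f' \<in> mor C A' B' \<and> g' \<in> mor C B' D' \<and>
     (\<exists>a b d. is_iso C A A' a \<and> is_iso C B B' b \<and> is_iso C D D' d \<and>
        Cmp C A B B' b f = Cmp C A A' B' f' a \<and>
        Cmp C B D D' d g = Cmp C B B' D' g' b))"

definition inflation :: "('o, 'm) short_seq set \<Rightarrow> 'o \<Rightarrow> 'o \<Rightarrow> 'm \<Rightarrow> bool" where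
  "inflation E A B f \<longleftrightarrow> (\<exists>g D. (A, f, B, g, D) \<in> E)"

definition deflation :: "('o, 'm) short_seq set \<Rightarrow> 'o \<Rightarrow> 'o \<Rightarrow> 'm \<Rightarrow> bool" where
  "deflation E B D g \<longleftrightarrow> (\<exists>A f. (A, f, B, g, D) \<in> E)"

(* Quillen's axioms in the self-dual form of Buehler, "Exact categories", Definition 2.1.
   E is the class of conflations. *)
locale exact_category = additive_category C
  for C :: "('o, 'm) cat" and E :: "('o, 'm) short_seq set" +
  assumes conflation_kernel_cokernel: "E \<subseteq> kernel_cokernel_pairs C"
    and conflation_iso_closed: "\<lbrakk>s \<in> E; seq_isomorphic C s t\<rbrakk> \<Longrightarrow> t \<in> E"
    and inflation_id: "A \<in> Obj C \<Longrightarrow> inflation E A A (Idm C A)"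
    and deflation_id: "A \<in> Obj C \<Longrightarrow> deflation E A A (Idm C A)"
    and inflation_comp:
      "\<lbrakk>inflation E A B f; inflation E B D g\<rbrakk> \<Longrightarrow> inflation E A D (Cmp C A B D g f)"
    and deflation_comp:
      "\<lbrakk>deflation E A B f; deflation E B D g\<rbrakk> \<Longrightarrow> deflation E A D (Cmp C A B D g f)"
    and inflation_pushout:
      "\<lbrakk>inflation E A B f; A' \<in> Obj C; a \<in> mor C A A'\<rbrakk>
        \<Longrightarrow> \<exists>B' f' b. is_pushout C A B A' B' f a b f' \<and> inflation E A' B' f'"
    and deflation_pullback:
      "\<lbrakk>deflation E B D g; D' \<in> Obj C; d \<in> mor C D' D\<rbrakk>
        \<Longrightarrow> \<exists>B' g' b. is_pullback C B' B D' D b g' g d \<and> deflation E B' D' g'"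

(* A full subcategory is given by its set of objects. *)
definition additive_subcategory :: "('o, 'm) cat \<Rightarrow> 'o set \<Rightarrow> bool" where
  "additive_subcategory C X \<longleftrightarrow>
     X \<subseteq> Obj C \<and>
     (\<forall>A B f. A \<in> X \<and> is_iso C A B f \<longrightarrow> B \<in> X) \<and>
     (\<forall>Z. is_zero_object C Z \<longrightarrow> Z \<in> X) \<and>
     (\<forall>A B S i j p q. A \<in> X \<and> B \<in> X \<and> is_biproduct C A B S i j p q \<longrightarrow> S \<in> X)"

definition X_monic :: "('o, 'm) cat \<Rightarrow> 'o set \<Rightarrow> 'o \<Rightarrow> 'o \<Rightarrow> 'm \<Rightarrow> bool" where
  "X_monic C X A B f \<longleftrightarrow> f \<in> mor C A B \<and>
     (\<forall>W \<in> X. (\<lambda>h. Cmp C A B W h f) ` mor C B W = mor C A W)"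

definition X_epic :: "('o, 'm) cat \<Rightarrow> 'o set \<Rightarrow> 'o \<Rightarrow> 'o \<Rightarrow> 'm \<Rightarrow> bool" where
  "X_epic C X A B f \<longleftrightarrow> f \<in> mor C A B \<and>
     (\<forall>W \<in> X. (\<lambda>h. Cmp C W A B f h) ` mor C W A = mor C W B)"

definition X_preenvelope :: "('o, 'm) cat \<Rightarrow> 'o set \<Rightarrow> 'o \<Rightarrow> 'o \<Rightarrow> 'm \<Rightarrow> bool" where
  "X_preenvelope C X A W f \<longleftrightarrow> W \<in> X \<and> X_monic C X A W f"

definition X_precover :: "('o, 'm) cat \<Rightarrow> 'o set \<Rightarrow> 'o \<Rightarrow> 'o \<Rightarrow> 'm \<Rightarrow> bool" where
  "X_precover C X W A f \<longleftrightarrow> W \<in> X \<and> X_epic C X W A f"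

definition X_complete_conflations ::
  "('o, 'm) cat \<Rightarrow> ('o, 'm) short_seq set \<Rightarrow> 'o set \<Rightarrow> ('o, 'm) short_seq set" where
  "X_complete_conflations C E X =
     {(A, f, B, g, D). (A, f, B, g, D) \<in> E \<and> X_monic C X A B f \<and> X_epic C X B D g}"

definition factoring :: "('o, 'm) cat \<Rightarrow> 'o set \<Rightarrow> 'o \<Rightarrow> 'o \<Rightarrow> 'm set" where
  "factoring C X A B = {Cmp C A W B v u | W u v. W \<in> X \<and> u \<in> mor C A W \<and> v \<in> mor C W B}"

(* the class of f : A -> B modulo morphisms factoring through an object of X, as a coset
   in the group Hom C A B *)
definition quot_class :: "('o, 'm) cat \<Rightarrow> 'o set \<Rightarrow> 'o \<Rightarrow> 'o \<Rightarrow> 'm \<Rightarrow> 'm set" where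
  "quot_class C X A B f = factoring C X A B #>\<^bsub>Hom C A B\<^esub> f"

(* The composite of two classes is the class of g o f for any representatives f and g; the
   union is over classes which all coincide. *)
definition quotient_cat :: "('o, 'm) cat \<Rightarrow> 'o set \<Rightarrow> ('o, 'm set) cat" where
  "quotient_cat C X =
     \<lparr>Obj = Obj C,
      Hom = (\<lambda>A B. Hom C A B Mod factoring C X A B),
      Cmp = (\<lambda>A B D G F. \<Union>g \<in> G. \<Union>f \<in> F. quot_class C X A D (Cmp C A B D g f)),
      Idm = (\<lambda>A. quot_class C X A A (Idm C A))\<rparr>"

definition induced_conflations ::
  "('o, 'm) cat \<Rightarrow> ('o, 'm) short_seq set \<Rightarrow> 'o set \<Rightarrow> ('o, 'm set) short_seq set" where
  "induced_conflations C E X =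
     {s. \<exists>A f B g D. (A, f, B, g, D) \<in> X_complete_conflations C E X \<and>
        seq_isomorphic (quotient_cat C X) s
          (A, quot_class C X A B f, B, quot_class C X B D g, D)}"

end

theory Submission imports Defs begin

text \<open>The proof rests on one observation: the quotient functor preserves pushouts of \<open>X\<close>-monic
  morphisms (\<open>cls_pushout\<close>). A square that commutes only up to a morphism through \<open>X\<close> can be
  corrected, because morphisms to objects of \<open>X\<close> extend along an \<open>X\<close>-monic morphism. That the
  induced morphism is unique modulo \<open>X\<close> is where the precovers whose kernel lies in \<open>X\<close> enter: a
  morphism whose two restrictions vanish modulo \<open>X\<close> lifts piecewise to the precover of its
  target, and the obstruction to gluing the pieces lives in the kernel, hence again extends.

  As objects of \<open>X\<close> become zero and cokernels are pushouts along zero, this gives at once that the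
  quotient has cokernels (push out a preenvelope of the domain) and that an \<open>X\<close>-complete
  conflation maps to a cokernel sequence. For the exactness axioms, it remains to see
  in the original category that \<open>X\<close>-complete conflations are stable under pushouts
  (\<open>complete_pushout\<close>) and that their inflations compose (\<open>complete_comp\<close>). Two inflations of the
  quotient that are composable there have representatives whose middle objects are merely
  isomorphic modulo \<open>X\<close>; pushing out along that isomorphism makes the representatives composable
  (\<open>induced_inflation_comp\<close>).

  The other half, on kernels, pullbacks and deflations, is the same statement in the opposite
  category: the hypotheses are self-dual and the quotient of the opposite is the opposite of the
  quotient (\<open>quotient_cat_op\<close>).\<close>

section \<open>Morphism arithmetic, kernels and isomorphisms\<close>

context preadditive_category
begin

lemma group_Hom: "\<lbrakk>A \<in> Obj C; B \<in> Obj C\<rbrakk> \<Longrightarrow> group (Hom C A B)"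
  using hom_comm_group comm_group_def by blast

lemma zero_closed: "\<lbrakk>A \<in> Obj C; B \<in> Obj C\<rbrakk> \<Longrightarrow> zero_mor C A B \<in> mor C A B"
  by (meson group_Hom group.is_monoid monoid.one_closed)

lemma add_closed:
  "\<lbrakk>A \<in> Obj C; B \<in> Obj C; f \<in> mor C A B; g \<in> mor C A B\<rbrakk> \<Longrightarrow> f \<otimes>\<^bsub>Hom C A B\<^esub> g \<in> mor C A B"
  by (meson group_Hom group.is_monoid monoid.m_closed)

lemma minus_closed:
  "\<lbrakk>A \<in> Obj C; B \<in> Obj C; f \<in> mor C A B\<rbrakk> \<Longrightarrow> inv\<^bsub>Hom C A B\<^esub> f \<in> mor C A B"
  by (meson group_Hom group.inv_closed)

lemma postcompose_group_hom:
  assumes "A \<in> Obj C" "B \<in> Obj C" "D \<in> Obj C" "g \<in> mor C B D"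
  shows "group_hom (Hom C A B) (Hom C A D) (Cmp C A B D g)"
  using assms comp_closed comp_add_right
  by (auto intro!: group_hom.intro group_Hom group_hom_axioms.intro homI)

lemma precompose_group_hom:
  assumes "A \<in> Obj C" "B \<in> Obj C" "D \<in> Obj C" "f \<in> mor C A B"
  shows "group_hom (Hom C B D) (Hom C A D) (\<lambda>g. Cmp C A B D g f)"
  using assms comp_closed comp_add_left
  by (auto intro!: group_hom.intro group_Hom group_hom_axioms.intro homI)

lemma comp_zero_right:
  "\<lbrakk>A \<in> Obj C; B \<in> Obj C; D \<in> Obj C; g \<in> mor C B D\<rbrakk>
    \<Longrightarrow> Cmp C A B D g (zero_mor C A B) = zero_mor C A D"
  using group_hom.hom_one[OF postcompose_group_hom] by blast

lemma comp_zero_left: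
  "\<lbrakk>A \<in> Obj C; B \<in> Obj C; D \<in> Obj C; f \<in> mor C A B\<rbrakk>
    \<Longrightarrow> Cmp C A B D (zero_mor C B D) f = zero_mor C A D"
  using group_hom.hom_one[OF precompose_group_hom] by blast

lemma comp_minus_right:
  "\<lbrakk>A \<in> Obj C; B \<in> Obj C; D \<in> Obj C; g \<in> mor C B D; f \<in> mor C A B\<rbrakk>
    \<Longrightarrow> Cmp C A B D g (inv\<^bsub>Hom C A B\<^esub> f) = inv\<^bsub>Hom C A D\<^esub> (Cmp C A B D g f)"
  using group_hom.hom_inv[OF postcompose_group_hom] by blast

lemma comp_minus_left:
  "\<lbrakk>A \<in> Obj C; B \<in> Obj C; D \<in> Obj C; g \<in> mor C B D; f \<in> mor C A B\<rbrakk>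
    \<Longrightarrow> Cmp C A B D (inv\<^bsub>Hom C B D\<^esub> g) f = inv\<^bsub>Hom C A D\<^esub> (Cmp C A B D g f)"
  using group_hom.hom_inv[OF precompose_group_hom] by blast

lemma diff_add_cancel:
  "\<lbrakk>A \<in> Obj C; B \<in> Obj C; f \<in> mor C A B; g \<in> mor C A B\<rbrakk>
    \<Longrightarrow> (f \<otimes>\<^bsub>Hom C A B\<^esub> inv\<^bsub>Hom C A B\<^esub> g) \<otimes>\<^bsub>Hom C A B\<^esub> g = f"
  using group_Hom[of A B] by (simp add: group.inv_solve_right' [symmetric] group.is_monoid monoid.m_closed
      group.inv_closed group.inv_inv monoid.m_assoc group.l_inv monoid.r_one)

lemma diff_eq_zero_iff:
  "\<lbrakk>A \<in> Obj C; B \<in> Obj C; f \<in> mor C A B; g \<in> mor C A B\<rbrakk>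
    \<Longrightarrow> f \<otimes>\<^bsub>Hom C A B\<^esub> inv\<^bsub>Hom C A B\<^esub> g = zero_mor C A B \<longleftrightarrow> f = g"
  by (metis diff_add_cancel group.r_inv group_Hom group.is_monoid monoid.l_one)

lemma zero_add:
  "\<lbrakk>A \<in> Obj C; B \<in> Obj C; f \<in> mor C A B\<rbrakk> \<Longrightarrow> zero_mor C A B \<otimes>\<^bsub>Hom C A B\<^esub> f = f"
  by (meson group_Hom group.is_monoid monoid.l_one)

lemma add_zero:
  "\<lbrakk>A \<in> Obj C; B \<in> Obj C; f \<in> mor C A B\<rbrakk> \<Longrightarrow> f \<otimes>\<^bsub>Hom C A B\<^esub> zero_mor C A B = f"
  by (meson group_Hom group.is_monoid monoid.r_one)

lemma kernel_mono:
  assumes "is_kernel C K A B k f" "T \<in> Obj C" "u \<in> mor C T K" "v \<in> mor C T K"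
    and "Cmp C T K A k u = Cmp C T K A k v"
  shows "u = v"
proof -
  have o: "K \<in> Obj C" "A \<in> Obj C" "B \<in> Obj C" "k \<in> mor C K A" "f \<in> mor C A B"
    and z: "Cmp C K A B f k = zero_mor C K B"
    using assms(1) by (auto simp: is_kernel_def)
  have "Cmp C T A B f (Cmp C T K A k u) = zero_mor C T B"
    using o assms z by (simp add: comp_assoc comp_zero_left)
  moreover have "Cmp C T K A k u \<in> mor C T A"
    using o assms comp_closed by blast
  ultimately have "\<exists>!w. w \<in> mor C T K \<and> Cmp C T K A k w = Cmp C T K A k u"
    using assms(1,2) unfolding is_kernel_def by blast
  then show ?thesis using assms(3-5) by metis
qed

lemma kernel_lift:
  assumes "is_kernel C K A B k f" "T \<in> Obj C" "t \<in> mor C T A" "Cmp C T A B f t = zero_mor C T B"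
  obtains u where "u \<in> mor C T K" "Cmp C T K A k u = t"
  using assms unfolding is_kernel_def by blast

text \<open>The form in which exactness gets used below: two morphisms that agree after \<open>f\<close> differ by
  one through the kernel.\<close>

lemma kernel_lift_diff:
  assumes K: "is_kernel C K A B k f" and T: "T \<in> Obj C" and xy: "x \<in> mor C T A" "y \<in> mor C T A"
    and eq: "Cmp C T A B f x = Cmp C T A B f y"
  obtains u where "u \<in> mor C T K" "x = Cmp C T K A k u \<otimes>\<^bsub>Hom C T A\<^esub> y"
proof -
  have o: "K \<in> Obj C" "A \<in> Obj C" "B \<in> Obj C" "k \<in> mor C K A" "f \<in> mor C A B"
    using K by (auto simp: is_kernel_def)
  let ?d = "x \<otimes>\<^bsub>Hom C T A\<^esub> inv\<^bsub>Hom C T A\<^esub> y"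
  have "Cmp C T A B f ?d = zero_mor C T B"
    using o T xy eq by (simp add: comp_add_right comp_minus_right minus_closed comp_closed diff_eq_zero_iff)
  moreover have "?d \<in> mor C T A" using o T xy by (simp add: add_closed minus_closed)
  ultimately obtain u where "u \<in> mor C T K" "Cmp C T K A k u = ?d"
    using kernel_lift[OF K T] by blast
  then show ?thesis using that diff_add_cancel o T xy by metis
qed

lemma iso_inverse:
  assumes "is_iso C A B f"
  obtains g where "is_iso C B A g" "Cmp C A B A g f = Idm C A" "Cmp C B A B f g = Idm C B"
  using assms unfolding is_iso_def by blast

lemma isoD: "is_iso C A B f \<Longrightarrow> A \<in> Obj C \<and> B \<in> Obj C \<and> f \<in> mor C A B"
  by (simp add: is_iso_def)

lemma iso_id: "A \<in> Obj C \<Longrightarrow> is_iso C A A (Idm C A)"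
  by (auto simp: is_iso_def id_closed comp_id_left intro!: bexI[of _ "Idm C A"])

lemma iso_cancel_left:
  assumes "A \<in> Obj C" "B \<in> Obj C" "D \<in> Obj C" "h \<in> mor C B D" "e \<in> mor C D B"
    "Cmp C B D B e h = Idm C B" "f \<in> mor C A B"
  shows "Cmp C A D B e (Cmp C A B D h f) = f"
  using assms by (simp add: comp_assoc comp_id_left)

lemma iso_cancel_right:
  assumes "A \<in> Obj C" "B \<in> Obj C" "D \<in> Obj C" "h \<in> mor C B D" "e \<in> mor C D B"
    "Cmp C B D B e h = Idm C B" "f \<in> mor C B A"
  shows "Cmp C B D A (Cmp C D B A f e) h = f"
  using assms by (simp add: comp_assoc[symmetric] comp_id_right)

lemma iso_comp:
  assumes "is_iso C A B f" "is_iso C B D g"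
  shows "is_iso C A D (Cmp C A B D g f)"
proof -
  obtain f' where f': "is_iso C B A f'" "Cmp C A B A f' f = Idm C A" "Cmp C B A B f f' = Idm C B"
    by (rule iso_inverse[OF assms(1)])
  obtain g' where g': "is_iso C D B g'" "Cmp C B D B g' g = Idm C B" "Cmp C D B D g g' = Idm C D"
    by (rule iso_inverse[OF assms(2)])
  note d = isoD[OF assms(1)] isoD[OF assms(2)] isoD[OF f'(1)] isoD[OF g'(1)]
  have "Cmp C A D A (Cmp C D B A f' g') (Cmp C A B D g f) =
      Cmp C A B A f' (Cmp C A D B g' (Cmp C A B D g f))"
    using d by (simp add: comp_assoc comp_closed)
  also have "\<dots> = Idm C A" using d f' g' by (simp add: iso_cancel_left)
  finally have 1: "Cmp C A D A (Cmp C D B A f' g') (Cmp C A B D g f) = Idm C A" .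
  have "Cmp C D A D (Cmp C A B D g f) (Cmp C D B A f' g') =
      Cmp C D B D g (Cmp C D A B f (Cmp C D B A f' g'))"
    using d by (simp add: comp_assoc comp_closed)
  also have "\<dots> = Idm C D" using d f' g' by (simp add: iso_cancel_left)
  finally show ?thesis using 1 d unfolding is_iso_def by (auto simp: comp_closed)
qed

section \<open>Isomorphic sequences\<close>

lemma square_inverse:
  assumes "A \<in> Obj C" "B \<in> Obj C" "A' \<in> Obj C" "B' \<in> Obj C"
    and "f \<in> mor C A B" "f' \<in> mor C A' B'"
    and "a \<in> mor C A A'" "b \<in> mor C B B'" "a' \<in> mor C A' A" "b' \<in> mor C B' B"
    and "Cmp C A' A A' a a' = Idm C A'" "Cmp C B B' B b' b = Idm C B"
    and sq: "Cmp C A B B' b f = Cmp C A A' B' f' a"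
  shows "Cmp C A' B' B b' f' = Cmp C A' A B f a'"
proof -
  have "Cmp C A' B' B b' f' = Cmp C A' B' B b' (Cmp C A' A B' (Cmp C A A' B' f' a) a')"
    using assms by (simp add: comp_assoc[symmetric] comp_id_right)
  also have "\<dots> = Cmp C A' B' B b' (Cmp C A' B B' b (Cmp C A' A B f a'))"
    using assms by (simp add: comp_assoc flip: sq)
  also have "\<dots> = Cmp C A' A B f a'"
    using assms by (simp add: iso_cancel_left comp_closed)
  finally show ?thesis .
qed

lemma square_paste:
  assumes "A \<in> Obj C" "B \<in> Obj C" "A' \<in> Obj C" "B' \<in> Obj C" "A'' \<in> Obj C" "B'' \<in> Obj C"
    and "f \<in> mor C A B" "f' \<in> mor C A' B'" "f'' \<in> mor C A'' B''"
    and "a \<in> mor C A A'" "b \<in> mor C B B'" "a' \<in> mor C A' A''" "b' \<in> mor C B' B''"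
    and sq: "Cmp C A B B' b f = Cmp C A A' B' f' a"
    and sq': "Cmp C A' B' B'' b' f' = Cmp C A' A'' B'' f'' a'"
  shows "Cmp C A B B'' (Cmp C B B' B'' b' b) f = Cmp C A A'' B'' f'' (Cmp C A A' A'' a' a)"
proof -
  have "Cmp C A B B'' (Cmp C B B' B'' b' b) f = Cmp C A B' B'' b' (Cmp C A A' B' f' a)"
    using assms by (simp add: comp_assoc[symmetric] flip: sq)
  also have "\<dots> = Cmp C A A' B'' (Cmp C A' A'' B'' f'' a') a"
    using assms by (simp add: comp_assoc flip: sq')
  also have "\<dots> = Cmp C A A'' B'' f'' (Cmp C A A' A'' a' a)"
    using assms by (simp add: comp_assoc[symmetric])
  finally show ?thesis .
qed

lemma seq_isomorphic_sym:
  assumes "seq_isomorphic C s t"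
  shows "seq_isomorphic C t s"
proof -
  obtain A f B g D A' f' B' g' D' where st: "s = (A,f,B,g,D)" "t = (A',f',B',g',D')"
    by (metis prod.exhaust)
  obtain a b d where i: "is_iso C A A' a" "is_iso C B B' b" "is_iso C D D' d"
    and m: "f \<in> mor C A B" "g \<in> mor C B D" "f' \<in> mor C A' B'" "g' \<in> mor C B' D'"
    and sq: "Cmp C A B B' b f = Cmp C A A' B' f' a" "Cmp C B D D' d g = Cmp C B B' D' g' b"
    using assms unfolding st seq_isomorphic_def by auto
  obtain a' where a': "is_iso C A' A a'" "Cmp C A A' A a' a = Idm C A" "Cmp C A' A A' a a' = Idm C A'"
    by (rule iso_inverse[OF i(1)])
  obtain b' where b': "is_iso C B' B b'" "Cmp C B B' B b' b = Idm C B" "Cmp C B' B B' b b' = Idm C B'"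
    by (rule iso_inverse[OF i(2)])
  obtain d' where d': "is_iso C D' D d'" "Cmp C D D' D d' d = Idm C D" "Cmp C D' D D' d d' = Idm C D'"
    by (rule iso_inverse[OF i(3)])
  note id = i[THEN isoD] a'(1)[THEN isoD] b'(1)[THEN isoD] d'(1)[THEN isoD]
  have "Cmp C A' B' B b' f' = Cmp C A' A B f a'" "Cmp C B' D' D d' g' = Cmp C B' B D g b'"
    using id m a' b' d' sq by (meson square_inverse)+
  then show ?thesis using m a' b' d' unfolding st seq_isomorphic_def by blast
qed

lemma seq_isomorphic_trans:
  assumes "seq_isomorphic C s t" "seq_isomorphic C t r"
  shows "seq_isomorphic C s r"
proof -
  obtain A f B g D A' f' B' g' D' A'' f'' B'' g'' D'' where
    st: "s = (A,f,B,g,D)" "t = (A',f',B',g',D')" "r = (A'',f'',B'',g'',D'')"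
    by (metis prod.exhaust)
  obtain a b d where i: "is_iso C A A' a" "is_iso C B B' b" "is_iso C D D' d"
    and m: "f \<in> mor C A B" "g \<in> mor C B D" "f' \<in> mor C A' B'" "g' \<in> mor C B' D'"
    and sq: "Cmp C A B B' b f = Cmp C A A' B' f' a" "Cmp C B D D' d g = Cmp C B B' D' g' b"
    using assms(1) unfolding st seq_isomorphic_def by auto
  obtain a' b' d' where i': "is_iso C A' A'' a'" "is_iso C B' B'' b'" "is_iso C D' D'' d'"
    and m': "f'' \<in> mor C A'' B''" "g'' \<in> mor C B'' D''"
    and sq': "Cmp C A' B' B'' b' f' = Cmp C A' A'' B'' f'' a'"
      "Cmp C B' D' D'' d' g' = Cmp C B' B'' D'' g'' b'"
    using assms(2) unfolding st seq_isomorphic_def by auto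
  note id = i[THEN isoD] i'[THEN isoD]
  have "Cmp C A B B'' (Cmp C B B' B'' b' b) f = Cmp C A A'' B'' f'' (Cmp C A A' A'' a' a)"
    "Cmp C B D D'' (Cmp C D D' D'' d' d) g = Cmp C B B'' D'' g'' (Cmp C B B' B'' b' b)"
    using id m m' sq sq' by (meson square_paste)+
  then show ?thesis using m m' i i' unfolding st seq_isomorphic_def by (blast intro: iso_comp)
qed

text \<open>Sequences of the induced structure are only isomorphic to images of conflations, so exactness
  has to be carried along an isomorphism of sequences.\<close>

lemma kernel_transport:
  assumes "seq_isomorphic C (A, f, B, g, D) (A', f', B', g', D')" and K: "is_kernel C A' B' D' f' g'"
  shows "is_kernel C A B D f g"
proof -
  obtain a b d where i: "is_iso C A A' a" "is_iso C B B' b" "is_iso C D D' d"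
    and m: "f \<in> mor C A B" "g \<in> mor C B D" "f' \<in> mor C A' B'" "g' \<in> mor C B' D'"
    and sq: "Cmp C A B B' b f = Cmp C A A' B' f' a" "Cmp C B D D' d g = Cmp C B B' D' g' b"
    using assms(1) unfolding seq_isomorphic_def by auto
  obtain a' where a': "is_iso C A' A a'" "Cmp C A A' A a' a = Idm C A" "Cmp C A' A A' a a' = Idm C A'"
    by (rule iso_inverse[OF i(1)])
  obtain b' where b': "is_iso C B' B b'" "Cmp C B B' B b' b = Idm C B" "Cmp C B' B B' b b' = Idm C B'"
    by (rule iso_inverse[OF i(2)])
  obtain d' where d': "is_iso C D' D d'" "Cmp C D D' D d' d = Idm C D" "Cmp C D' D D' d d' = Idm C D'"
    by (rule iso_inverse[OF i(3)])
  note id = i[THEN isoD] a'(1)[THEN isoD] b'(1)[THEN isoD] d'(1)[THEN isoD]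
  have sq': "Cmp C A' B' B b' f' = Cmp C A' A B f a'"
    using id m a' b' sq by (meson square_inverse)
  have z': "Cmp C A' B' D' g' f' = zero_mor C A' D'" using K by (simp add: is_kernel_def)
  have "Cmp C A D D' d (Cmp C A B D g f) = Cmp C A B D' (Cmp C B B' D' g' b) f"
    using id m sq by (simp add: comp_assoc)
  also have "\<dots> = Cmp C A B' D' g' (Cmp C A A' B' f' a)"
    using id m sq by (simp add: comp_assoc[symmetric])
  also have "\<dots> = zero_mor C A D'"
    using id m z' by (simp add: comp_assoc comp_zero_left)
  finally have "Cmp C A D' D d' (Cmp C A D D' d (Cmp C A B D g f)) = Cmp C A D' D d' (zero_mor C A D')"
    by simp
  then have zero: "Cmp C A B D g f = zero_mor C A D"
    using id m d' by (simp add: iso_cancel_left comp_closed comp_zero_right)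
  have "\<exists>!u. u \<in> mor C T A \<and> Cmp C T A B f u = t"
    if T: "T \<in> Obj C" and t: "t \<in> mor C T B" and gt: "Cmp C T B D g t = zero_mor C T D" for T t
  proof -
    have "Cmp C T B' D' g' (Cmp C T B B' b t) = Cmp C T D D' d (Cmp C T B D g t)"
      using id m T t sq by (simp add: comp_assoc)
    also have "\<dots> = zero_mor C T D'" using gt id T by (simp add: comp_zero_right)
    finally obtain v where v: "v \<in> mor C T A'" "Cmp C T A' B' f' v = Cmp C T B B' b t"
      using K T t id by (meson kernel_lift comp_closed)
    have "Cmp C T A B f (Cmp C T A' A a' v) = Cmp C T A' B (Cmp C A' B' B b' f') v"
      using id m T v sq' by (simp add: comp_assoc)
    also have "\<dots> = Cmp C T B' B b' (Cmp C T B B' b t)"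
      using id m T v by (simp add: comp_assoc[symmetric])
    also have "\<dots> = t" using id b' T t by (simp add: iso_cancel_left)
    finally have ex: "Cmp C T A' A a' v \<in> mor C T A" "Cmp C T A B f (Cmp C T A' A a' v) = t"
      using id T v comp_closed by auto
    have "u = w" if uw: "u \<in> mor C T A" "w \<in> mor C T A" "Cmp C T A B f u = Cmp C T A B f w" for u w
    proof -
      have "Cmp C T A' B' f' (Cmp C T A A' a x) = Cmp C T B B' b (Cmp C T A B f x)"
        if "x \<in> mor C T A" for x
        using id m T that sq by (simp add: comp_assoc)
      then have "Cmp C T A' B' f' (Cmp C T A A' a u) = Cmp C T A' B' f' (Cmp C T A A' a w)"
        using uw by simp
      then have "Cmp C T A A' a u = Cmp C T A A' a w"
        using kernel_mono[OF K T] id T uw comp_closed by blast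
      then show ?thesis using id uw T a' by (metis iso_cancel_left)
    qed
    with ex show ?thesis by metis
  qed
  with id m zero show ?thesis unfolding is_kernel_def by auto
qed

end

section \<open>The opposite category\<close>

text \<open>All hypotheses and conclusions are self-dual, and forming the quotient commutes with passing
  to the opposite category on the nose. Hence, for the quotient, only statements about cokernels,
  pushouts and inflations are proved by hand; those about kernels, pullbacks and deflations are
  their instances in the opposite category.\<close>

definition op_cat :: "('o, 'm) cat \<Rightarrow> ('o, 'm) cat" where
  "op_cat C = \<lparr>Obj = Obj C, Hom = (\<lambda>A B. Hom C B A),
     Cmp = (\<lambda>A B D g f. Cmp C D B A f g), Idm = Idm C\<rparr>"

definition op_seqs :: "('o, 'm) short_seq set \<Rightarrow> ('o, 'm) short_seq set" where
  "op_seqs E = {(A, f, B, g, D). (D, g, B, f, A) \<in> E}"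

lemma op_cat_simps [simp]:
  "Obj (op_cat C) = Obj C"
  "Hom (op_cat C) A B = Hom C B A"
  "Cmp (op_cat C) A B D g f = Cmp C D B A f g"
  "Idm (op_cat C) = Idm C"
  by (simp_all add: op_cat_def)

lemma mem_op_seqs [simp]: "(A, f, B, g, D) \<in> op_seqs E \<longleftrightarrow> (D, g, B, f, A) \<in> E"
  by (simp add: op_seqs_def)

lemma is_kernel_op: "is_kernel (op_cat C) Q B A c f \<longleftrightarrow> is_cokernel C A B Q f c"
  unfolding is_kernel_def is_cokernel_def by auto

lemma is_cokernel_op: "is_cokernel (op_cat C) A B Q f c \<longleftrightarrow> is_kernel C Q B A c f"
  unfolding is_kernel_def is_cokernel_def by auto

lemma is_pullback_op: "is_pullback (op_cat C) P A B D p q f g \<longleftrightarrow> is_pushout C D A B P f g p q"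
  unfolding is_pullback_def is_pushout_def by auto

lemma is_pushout_op: "is_pushout (op_cat C) D A B P f g p q \<longleftrightarrow> is_pullback C P A B D p q f g"
  unfolding is_pullback_def is_pushout_def by auto

lemma is_iso_op: "is_iso (op_cat C) A B f \<longleftrightarrow> is_iso C B A f"
  unfolding is_iso_def by auto

lemma is_zero_object_op: "is_zero_object (op_cat C) Z \<longleftrightarrow> is_zero_object C Z"
  unfolding is_zero_object_def by auto

lemma is_biproduct_op: "is_biproduct (op_cat C) A B S i j p q \<longleftrightarrow> is_biproduct C A B S p q i j"
  unfolding is_biproduct_def by auto

lemma inflation_op: "inflation (op_seqs E) A B f \<longleftrightarrow> deflation E B A f"
  by (auto simp: inflation_def deflation_def)

lemma deflation_op: "deflation (op_seqs E) A B f \<longleftrightarrow> inflation E B A f"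
  by (auto simp: inflation_def deflation_def)

lemma X_monic_op: "X_monic (op_cat C) X A B f \<longleftrightarrow> X_epic C X B A f"
  by (simp add: X_monic_def X_epic_def)

lemma X_epic_op: "X_epic (op_cat C) X A B f \<longleftrightarrow> X_monic C X B A f"
  by (simp add: X_monic_def X_epic_def)

lemma X_complete_conflations_op:
  "X_complete_conflations (op_cat C) (op_seqs E) X = op_seqs (X_complete_conflations C E X)"
  by (auto simp: X_complete_conflations_def X_monic_op X_epic_op)

lemma (in preadditive_category) preadditive_category_op: "preadditive_category (op_cat C)"
  by (rule preadditive_category.intro)
    (simp_all add: comp_closed comp_assoc id_closed comp_id_left comp_id_right hom_comm_group
      comp_add_left comp_add_right)

lemma (in additive_category) additive_category_op: "additive_category (op_cat C)"
proof -
  interpret op: preadditive_category "op_cat C" by (rule preadditive_category_op)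
  show ?thesis
    by unfold_locales (use ex_zero_object ex_biproduct in
      \<open>fastforce simp: is_zero_object_op is_biproduct_op\<close>)+
qed

lemma (in preadditive_category) seq_isomorphic_op:
  "seq_isomorphic (op_cat C) (A, f, B, g, D) (A', f', B', g', D')
    \<longleftrightarrow> seq_isomorphic C (D, g, B, f, A) (D', g', B', f', A')"
proof -
  have "seq_isomorphic (op_cat C) (A, f, B, g, D) (A', f', B', g', D')
      \<longleftrightarrow> seq_isomorphic C (D', g', B', f', A') (D, g, B, f, A)"
    unfolding seq_isomorphic_def by (auto simp: is_iso_op) metis+
  then show ?thesis using seq_isomorphic_sym by blast
qed

lemma (in exact_category) exact_category_op: "exact_category (op_cat C) (op_seqs E)"
proof -
  interpret op: additive_category "op_cat C" by (rule additive_category_op)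
  show ?thesis
  proof
    show "op_seqs E \<subseteq> kernel_cokernel_pairs (op_cat C)"
      using conflation_kernel_cokernel
      by (auto simp: kernel_cokernel_pairs_def is_kernel_op is_cokernel_op)
    show "t \<in> op_seqs E" if s: "s \<in> op_seqs E" and st: "seq_isomorphic (op_cat C) s t" for s t
    proof -
      obtain A f B g D A' f' B' g' D' where e: "s = (A,f,B,g,D)" "t = (A',f',B',g',D')"
        by (metis prod.exhaust)
      then have "(D, g, B, f, A) \<in> E" "seq_isomorphic C (D, g, B, f, A) (D', g', B', f', A')"
        using s st seq_isomorphic_op by auto
      then show ?thesis using e conflation_iso_closed by auto
    qed
  qed (use inflation_id deflation_id inflation_comp deflation_comp inflation_pushout
      deflation_pullback in \<open>auto simp: inflation_op deflation_op is_pushout_op is_pullback_op\<close>)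
qed

section \<open>Cokernels and pushouts\<close>

context preadditive_category
begin

lemma cokernel_epi:
  "\<lbrakk>is_cokernel C A B Q f c; T \<in> Obj C; u \<in> mor C Q T; v \<in> mor C Q T;
    Cmp C B Q T u c = Cmp C B Q T v c\<rbrakk> \<Longrightarrow> u = v"
  using preadditive_category.kernel_mono[OF preadditive_category_op, of Q B A c f T u v]
  by (simp add: is_kernel_op)

lemma cokernel_factor:
  assumes "is_cokernel C A B Q f c" "T \<in> Obj C" "t \<in> mor C B T" "Cmp C A B T t f = zero_mor C A T"
  obtains u where "u \<in> mor C Q T" "Cmp C B Q T u c = t"
  using assms unfolding is_cokernel_def by blast

lemma cokernel_transport:
  "\<lbrakk>seq_isomorphic C (A, f, B, g, D) (A', f', B', g', D'); is_cokernel C A' B' D' f' g'\<rbrakk>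
    \<Longrightarrow> is_cokernel C A B D f g"
  using preadditive_category.kernel_transport[OF preadditive_category_op, of D g B f A D' g' B' f' A']
  by (simp add: is_kernel_op seq_isomorphic_op)

lemma pushout_joint_epi:
  assumes P: "is_pushout C D A B P f g p q" and "T \<in> Obj C" "u \<in> mor C P T" "v \<in> mor C P T"
    and eq: "Cmp C A P T u p = Cmp C A P T v p" "Cmp C B P T u q = Cmp C B P T v q"
  shows "u = v"
proof -
  have o: "P \<in> Obj C" "A \<in> Obj C" "B \<in> Obj C" "D \<in> Obj C"
    "f \<in> mor C D A" "g \<in> mor C D B" "p \<in> mor C A P" "q \<in> mor C B P"
    "Cmp C D A P p f = Cmp C D B P q g"
    using P by (auto simp: is_pushout_def)
  have "Cmp C D A T (Cmp C A P T u p) f = Cmp C D B T (Cmp C B P T u q) g"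
    using o assms by (simp add: comp_assoc[symmetric])
  moreover have "Cmp C A P T u p \<in> mor C A T" "Cmp C B P T u q \<in> mor C B T"
    using o assms comp_closed by auto
  ultimately have "\<exists>!w. w \<in> mor C P T \<and> Cmp C A P T w p = Cmp C A P T u p
      \<and> Cmp C B P T w q = Cmp C B P T u q"
    using P assms(2) unfolding is_pushout_def by blast
  then show ?thesis using assms(3,4) eq by metis
qed

lemma pushout_desc:
  assumes "is_pushout C D A B P f g p q" "T \<in> Obj C" "s \<in> mor C A T" "t \<in> mor C B T"
    "Cmp C D A T s f = Cmp C D B T t g"
  obtains u where "u \<in> mor C P T" "Cmp C A P T u p = s" "Cmp C B P T u q = t"
  using assms unfolding is_pushout_def by blast

lemma pushoutI:
  assumes "P \<in> Obj C" "A \<in> Obj C" "B \<in> Obj C" "D \<in> Obj C"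
    "f \<in> mor C D A" "g \<in> mor C D B" "p \<in> mor C A P" "q \<in> mor C B P"
    "Cmp C D A P p f = Cmp C D B P q g"
    and ex: "\<And>T s t. \<lbrakk>T \<in> Obj C; s \<in> mor C A T; t \<in> mor C B T; Cmp C D A T s f = Cmp C D B T t g\<rbrakk>
      \<Longrightarrow> \<exists>u \<in> mor C P T. Cmp C A P T u p = s \<and> Cmp C B P T u q = t"
    and unique: "\<And>T u v. \<lbrakk>T \<in> Obj C; u \<in> mor C P T; v \<in> mor C P T;
        Cmp C A P T u p = Cmp C A P T v p; Cmp C B P T u q = Cmp C B P T v q\<rbrakk> \<Longrightarrow> u = v"
  shows "is_pushout C D A B P f g p q"
proof -
  have "\<exists>!u. u \<in> mor C P T \<and> Cmp C A P T u p = s \<and> Cmp C B P T u q = t"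
    if h: "T \<in> Obj C" "s \<in> mor C A T" "t \<in> mor C B T" "Cmp C D A T s f = Cmp C D B T t g" for T s t
  proof -
    obtain u where "u \<in> mor C P T" "Cmp C A P T u p = s" "Cmp C B P T u q = t"
      using ex[OF h] by blast
    moreover have "v = u" if "v \<in> mor C P T" "Cmp C A P T v p = s" "Cmp C B P T v q = t" for v
      using unique[OF h(1), of v u] that calculation by simp
    ultimately show ?thesis by blast
  qed
  then show ?thesis using assms unfolding is_pushout_def by auto
qed

lemma pushout_sym:
  "is_pushout C D A B P f g p q \<Longrightarrow> is_pushout C D B A P g f q p"
  unfolding is_pushout_def by (simp add: conj_commute)

lemma zero_object_mor_eq:
  assumes "is_zero_object C Z" "A \<in> Obj C"
  shows "f \<in> mor C Z A \<Longrightarrow> g \<in> mor C Z A \<Longrightarrow> f = g" "f \<in> mor C A Z \<Longrightarrow> g \<in> mor C A Z \<Longrightarrow> f = g"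
  using assms unfolding is_zero_object_def by blast+

text \<open>Cokernels are pushouts along a zero object. This lets a single theorem on pushouts in the
  quotient category also yield the existence of cokernels and the fact that complete
  conflations become cokernel sequences.\<close>

lemma pushout_along_zero_is_cokernel:
  assumes Z: "is_zero_object C Z" and P: "is_pushout C A B Z Q f z c z'"
  shows "is_cokernel C A B Q f c"
proof -
  have o: "Q \<in> Obj C" "B \<in> Obj C" "Z \<in> Obj C" "A \<in> Obj C"
    "f \<in> mor C A B" "z \<in> mor C A Z" "c \<in> mor C B Q" "z' \<in> mor C Z Q"
    "Cmp C A B Q c f = Cmp C A Z Q z' z"
    using P by (auto simp: is_pushout_def)
  have z0: "z = zero_mor C A Z" using zero_object_mor_eq[OF Z] o zero_closed by blast
  have "\<exists>!u. u \<in> mor C Q T \<and> Cmp C B Q T u c = t"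
    if T: "T \<in> Obj C" and t: "t \<in> mor C B T" and tf: "Cmp C A B T t f = zero_mor C A T" for T t
  proof -
    have "Cmp C A B T t f = Cmp C A Z T (zero_mor C Z T) z"
      using tf z0 o T zero_closed comp_zero_left by simp
    then obtain u where u: "u \<in> mor C Q T" "Cmp C B Q T u c = t"
      using pushout_desc[OF P T t zero_closed[of Z T]] o T by blast
    have "v = u" if v: "v \<in> mor C Q T" "Cmp C B Q T v c = t" for v
    proof (rule pushout_joint_epi[OF P T v(1) u(1)])
      show "Cmp C B Q T v c = Cmp C B Q T u c" using u v by simp
      show "Cmp C Z Q T v z' = Cmp C Z Q T u z'"
        by (rule zero_object_mor_eq(1)[OF Z T]) (use o T u v comp_closed in auto)
    qed
    then show ?thesis using u by blast
  qed
  moreover have "Cmp C A B Q c f = zero_mor C A Q"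
    using o z0 comp_zero_right by simp
  ultimately show ?thesis using o unfolding is_cokernel_def by auto
qed

lemma cokernel_is_pushout_along_zero:
  assumes Z: "is_zero_object C Z" and Q: "is_cokernel C A B Q f c"
  shows "is_pushout C A B Z Q f (zero_mor C A Z) c (zero_mor C Z Q)"
proof (rule pushoutI)
  have zZ: "Z \<in> Obj C" using Z by (simp add: is_zero_object_def)
  have o: "Q \<in> Obj C" "B \<in> Obj C" "A \<in> Obj C" "f \<in> mor C A B" "c \<in> mor C B Q"
    "Cmp C A B Q c f = zero_mor C A Q"
    using Q by (auto simp: is_cokernel_def)
  show "Cmp C A B Q c f = Cmp C A Z Q (zero_mor C Z Q) (zero_mor C A Z)"
    using o zZ by (simp add: zero_closed comp_zero_right)
  show "Q \<in> Obj C" "B \<in> Obj C" "Z \<in> Obj C" "A \<in> Obj C" "f \<in> mor C A B" "c \<in> mor C B Q"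
    "zero_mor C A Z \<in> mor C A Z" "zero_mor C Z Q \<in> mor C Z Q"
    using o zZ zero_closed by auto
  show "\<exists>u \<in> mor C Q T. Cmp C B Q T u c = s \<and> Cmp C Z Q T u (zero_mor C Z Q) = t"
    if T: "T \<in> Obj C" and s: "s \<in> mor C B T" and t: "t \<in> mor C Z T"
      and eq: "Cmp C A B T s f = Cmp C A Z T t (zero_mor C A Z)" for T s t
  proof -
    have "Cmp C A B T s f = zero_mor C A T" using eq o zZ T t comp_zero_right by simp
    then obtain u where u: "u \<in> mor C Q T" "Cmp C B Q T u c = s" by (rule cokernel_factor[OF Q T s])
    moreover have "Cmp C Z Q T u (zero_mor C Z Q) = t"
      by (rule zero_object_mor_eq(1)[OF Z T]) (use o zZ T u t comp_closed zero_closed in auto)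
    ultimately show ?thesis by blast
  qed
  show "u = v" if "T \<in> Obj C" "u \<in> mor C Q T" "v \<in> mor C Q T" "Cmp C B Q T u c = Cmp C B Q T v c"
    for T u v using cokernel_epi[OF Q that] .
qed

lemma pushout_of_iso:
  assumes P: "is_pushout C D A B P f g p q" and g: "is_iso C D B g"
  shows "is_iso C A P p"
proof -
  have o: "P \<in> Obj C" "A \<in> Obj C" "B \<in> Obj C" "D \<in> Obj C"
    "f \<in> mor C D A" "g \<in> mor C D B" "p \<in> mor C A P" "q \<in> mor C B P"
    and sq: "Cmp C D A P p f = Cmp C D B P q g"
    using P by (auto simp: is_pushout_def)
  obtain h where h: "is_iso C B D h" "Cmp C D B D h g = Idm C D" "Cmp C B D B g h = Idm C B"
    by (rule iso_inverse[OF g])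
  have hm: "h \<in> mor C B D" using h isoD by blast
  have e: "Cmp C D A A (Idm C A) f = Cmp C D B A (Cmp C B D A f h) g"
    using o h hm by (simp add: comp_id_left iso_cancel_right)
  obtain u where u: "u \<in> mor C P A" "Cmp C A P A u p = Idm C A" "Cmp C B P A u q = Cmp C B D A f h"
    by (rule pushout_desc[OF P _ _ _ e]) (use o hm id_closed comp_closed in auto)
  have "Cmp C P A P p u = Idm C P"
  proof (rule pushout_joint_epi[OF P o(1)])
    show "Cmp C A P P (Cmp C P A P p u) p = Cmp C A P P (Idm C P) p"
      using o u by (simp add: comp_assoc[symmetric] comp_id_left comp_id_right)
    have "Cmp C B P P (Cmp C P A P p u) q = Cmp C B A P p (Cmp C B D A f h)"
      using o u by (simp add: comp_assoc[symmetric])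
    also have "\<dots> = Cmp C B D P (Cmp C D B P q g) h"
      using o hm by (simp add: comp_assoc flip: sq)
    also have "\<dots> = Cmp C B P P (Idm C P) q"
      using o h hm by (simp add: comp_assoc[symmetric] comp_id_left comp_id_right)
    finally show "Cmp C B P P (Cmp C P A P p u) q = Cmp C B P P (Idm C P) q" .
  qed (use o u id_closed comp_closed in auto)
  then show ?thesis using o u unfolding is_iso_def by auto
qed

text \<open>Pushouts of arbitrary inflations of the quotient category are obtained from those of the
  complete conflations representing them, to which they are isomorphic as arrows.\<close>

lemma pushout_of_isomorphic_arrow:
  assumes P: "is_pushout C D' A' B P f' g p q" and d: "is_iso C D D' d" and a: "is_iso C A A' a"
    and f: "f \<in> mor C D A" and sq: "Cmp C D A A' a f = Cmp C D D' A' f' d"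
  shows "is_pushout C D A B P f (Cmp C D D' B g d) (Cmp C A A' P p a) q"
proof -
  have o: "P \<in> Obj C" "A' \<in> Obj C" "B \<in> Obj C" "D' \<in> Obj C"
    "f' \<in> mor C D' A'" "g \<in> mor C D' B" "p \<in> mor C A' P" "q \<in> mor C B P"
    and Psq: "Cmp C D' A' P p f' = Cmp C D' B P q g"
    using P by (auto simp: is_pushout_def)
  obtain d' where d': "is_iso C D' D d'" "Cmp C D D' D d' d = Idm C D" "Cmp C D' D D' d d' = Idm C D'"
    by (rule iso_inverse[OF d])
  obtain a' where a': "is_iso C A' A a'" "Cmp C A A' A a' a = Idm C A" "Cmp C A' A A' a a' = Idm C A'"
    by (rule iso_inverse[OF a])
  note m = d[THEN isoD] a[THEN isoD] d'(1)[THEN isoD] a'(1)[THEN isoD]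
  have sq': "Cmp C D' A' A a' f' = Cmp C D' D A f d'"
    by (rule square_inverse) (use o f m d' a' sq in auto)
  show ?thesis
  proof (rule pushoutI)
    have "Cmp C D A P (Cmp C A A' P p a) f = Cmp C D D' P (Cmp C D' A' P p f') d"
      using o m f sq by (simp add: comp_assoc[symmetric])
    then show "Cmp C D A P (Cmp C A A' P p a) f = Cmp C D B P q (Cmp C D D' B g d)"
      using o m Psq by (simp add: comp_assoc)
    show "\<exists>u \<in> mor C P T. Cmp C A P T u (Cmp C A A' P p a) = s \<and> Cmp C B P T u q = t"
      if T: "T \<in> Obj C" and s: "s \<in> mor C A T" and t: "t \<in> mor C B T"
        and eq: "Cmp C D A T s f = Cmp C D B T t (Cmp C D D' B g d)" for T s t
    proof -
      have "Cmp C D' A' T (Cmp C A' A T s a') f' = Cmp C D' D T (Cmp C D A T s f) d'"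
        using o m f T s sq' by (simp add: comp_assoc[symmetric])
      also have "\<dots> = Cmp C D' B T t (Cmp C D' D B (Cmp C D D' B g d) d')"
        using eq o m T t by (simp add: comp_assoc comp_closed)
      also have "\<dots> = Cmp C D' B T t g"
        using o m d' by (simp add: iso_cancel_right)
      finally have e: "Cmp C D' A' T (Cmp C A' A T s a') f' = Cmp C D' B T t g" .
      obtain u where u: "u \<in> mor C P T" "Cmp C A' P T u p = Cmp C A' A T s a'"
        "Cmp C B P T u q = t"
        by (rule pushout_desc[OF P T _ t e]) (use T s m comp_closed in auto)
      have "Cmp C A P T u (Cmp C A A' P p a) = s"
        using u o m a' T s by (simp add: comp_assoc iso_cancel_right)
      then show ?thesis using u by blast
    qed
    show "u = v" if T: "T \<in> Obj C" and uv: "u \<in> mor C P T" "v \<in> mor C P T"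
      and eq: "Cmp C A P T u (Cmp C A A' P p a) = Cmp C A P T v (Cmp C A A' P p a)"
        "Cmp C B P T u q = Cmp C B P T v q" for T u v
    proof (rule pushout_joint_epi[OF P T uv])
      have "Cmp C A A' T (Cmp C A' P T u p) a = Cmp C A A' T (Cmp C A' P T v p) a"
        using eq o m T uv by (simp add: comp_assoc)
      then have "Cmp C A' A T (Cmp C A A' T (Cmp C A' P T u p) a) a' =
          Cmp C A' A T (Cmp C A A' T (Cmp C A' P T v p) a) a'" by simp
      then show "Cmp C A' P T u p = Cmp C A' P T v p"
        using o m T uv a' by (simp add: iso_cancel_right comp_closed)
    qed (rule eq(2))
  qed (use o m f comp_closed in auto)
qed

end

section \<open>The ideal quotient\<close>

locale additive_quotient = additive_category C for C :: "('o, 'm) cat" +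
  fixes X :: "'o set"
  assumes additive_sub: "additive_subcategory C X"
begin

abbreviation Q :: "('o, 'm set) cat" where "Q \<equiv> quotient_cat C X"

abbreviation cls :: "'o \<Rightarrow> 'o \<Rightarrow> 'm \<Rightarrow> 'm set" where "cls \<equiv> quot_class C X"

lemma X_obj: "W \<in> X \<Longrightarrow> W \<in> Obj C"
  using additive_sub unfolding additive_subcategory_def by blast

lemma ex_zero_object_in_X: obtains Z where "is_zero_object C Z" "Z \<in> X"
  using ex_zero_object additive_sub unfolding additive_subcategory_def by blast

lemma X_biproduct: "\<lbrakk>is_biproduct C A B S i j p q; A \<in> X; B \<in> X\<rbrakk> \<Longrightarrow> S \<in> X"
  using additive_sub unfolding additive_subcategory_def by blast

lemma factoringI:
  "\<lbrakk>W \<in> X; u \<in> mor C A W; v \<in> mor C W B\<rbrakk> \<Longrightarrow> Cmp C A W B v u \<in> factoring C X A B"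
  unfolding factoring_def by blast

lemma factoringE:
  assumes "h \<in> factoring C X A B"
  obtains W u v where "W \<in> X" "u \<in> mor C A W" "v \<in> mor C W B" "h = Cmp C A W B v u"
  using assms unfolding factoring_def by blast

lemma factoring_closed:
  "\<lbrakk>A \<in> Obj C; B \<in> Obj C; h \<in> factoring C X A B\<rbrakk> \<Longrightarrow> h \<in> mor C A B"
  by (elim factoringE) (simp add: X_obj comp_closed)

lemma factoring_postcompose:
  assumes "A \<in> Obj C" "B \<in> Obj C" "D \<in> Obj C" "h \<in> factoring C X A B" "g \<in> mor C B D"
  shows "Cmp C A B D g h \<in> factoring C X A D"
proof -
  obtain W u v where w: "W \<in> X" "u \<in> mor C A W" "v \<in> mor C W B" "h = Cmp C A W B v u"
    using assms(4) by (rule factoringE)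
  then have "Cmp C A B D g h = Cmp C A W D (Cmp C W B D g v) u"
    using assms X_obj by (simp add: comp_assoc)
  moreover have "Cmp C W B D g v \<in> mor C W D" using w assms X_obj comp_closed by simp
  ultimately show ?thesis using factoringI[OF w(1,2)] by simp
qed

lemma factoring_precompose:
  assumes "A \<in> Obj C" "B \<in> Obj C" "D \<in> Obj C" "f \<in> mor C A B" "h \<in> factoring C X B D"
  shows "Cmp C A B D h f \<in> factoring C X A D"
proof -
  obtain W u v where w: "W \<in> X" "u \<in> mor C B W" "v \<in> mor C W D" "h = Cmp C B W D v u"
    using assms(5) by (rule factoringE)
  then have "Cmp C A B D h f = Cmp C A W D v (Cmp C A B W u f)"
    using assms X_obj by (simp add: comp_assoc)
  moreover have "Cmp C A B W u f \<in> mor C A W" using w assms X_obj comp_closed by simp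
  ultimately show ?thesis using factoringI[OF w(1) _ w(3)] by simp
qed

text \<open>Closure under addition is where biproducts enter: the sum of a morphism through \<open>W\<close> and
  one through \<open>V\<close> factors through the biproduct of \<open>W\<close> and \<open>V\<close>.\<close>

lemma subgroup_factoring:
  assumes o: "A \<in> Obj C" "B \<in> Obj C"
  shows "subgroup (factoring C X A B) (Hom C A B)"
proof (rule subgroup.intro)
  show "factoring C X A B \<subseteq> mor C A B" using o factoring_closed by blast
  obtain Z where Z: "is_zero_object C Z" "Z \<in> X" by (rule ex_zero_object_in_X)
  have "Cmp C A Z B (zero_mor C Z B) (zero_mor C A Z) \<in> factoring C X A B"
    using Z o by (auto intro!: factoringI zero_closed X_obj)
  then show "zero_mor C A B \<in> factoring C X A B"
    using Z o by (simp add: comp_zero_right zero_closed X_obj)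
  show "inv\<^bsub>Hom C A B\<^esub> h \<in> factoring C X A B" if h: "h \<in> factoring C X A B" for h
  proof -
    obtain W u v where w: "W \<in> X" "u \<in> mor C A W" "v \<in> mor C W B" "h = Cmp C A W B v u"
      using h by (rule factoringE)
    then have "inv\<^bsub>Hom C A B\<^esub> h = Cmp C A W B (inv\<^bsub>Hom C W B\<^esub> v) u"
      using o X_obj by (simp add: comp_minus_left)
    moreover have "inv\<^bsub>Hom C W B\<^esub> v \<in> mor C W B" using w o minus_closed X_obj by blast
    ultimately show ?thesis using factoringI[OF w(1,2)] by simp
  qed
  show "h \<otimes>\<^bsub>Hom C A B\<^esub> h' \<in> factoring C X A B"
    if h: "h \<in> factoring C X A B" "h' \<in> factoring C X A B" for h h'
  proof -
    obtain W u v where w: "W \<in> X" "u \<in> mor C A W" "v \<in> mor C W B" "h = Cmp C A W B v u"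
      using h(1) by (rule factoringE)
    obtain V u' v' where w': "V \<in> X" "u' \<in> mor C A V" "v' \<in> mor C V B" "h' = Cmp C A V B v' u'"
      using h(2) by (rule factoringE)
    have wo: "W \<in> Obj C" "V \<in> Obj C" using w w' X_obj by auto
    obtain S i j p q where S: "is_biproduct C W V S i j p q"
      using ex_biproduct wo by blast
    then have sm: "S \<in> Obj C" "i \<in> mor C W S" "j \<in> mor C V S" "p \<in> mor C S W" "q \<in> mor C S V"
      and se: "Cmp C W S W p i = Idm C W" "Cmp C V S V q j = Idm C V"
        "Cmp C V S W p j = zero_mor C V W" "Cmp C W S V q i = zero_mor C W V"
      unfolding is_biproduct_def by auto
    have SX: "S \<in> X" using X_biproduct[OF S] w w' by blast
    let ?x = "Cmp C A W S i u \<otimes>\<^bsub>Hom C A S\<^esub> Cmp C A V S j u'"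
    let ?y = "Cmp C S W B v p \<otimes>\<^bsub>Hom C S B\<^esub> Cmp C S V B v' q"
    have x: "?x \<in> mor C A S" and y: "?y \<in> mor C S B"
      using o wo sm w w' by (simp_all add: add_closed comp_closed)
    have p: "Cmp C A S W p ?x = u"
      using o wo sm w w' se
      by (simp add: comp_add_right comp_closed comp_assoc comp_id_left comp_zero_left add_zero)
    have q: "Cmp C A S V q ?x = u'"
      using o wo sm w w' se
      by (simp add: comp_add_right comp_closed comp_assoc comp_id_left comp_zero_left zero_add)
    have "Cmp C A S B ?y ?x = h \<otimes>\<^bsub>Hom C A B\<^esub> h'"
    proof -
      have "Cmp C A S B ?y ?x = Cmp C A S B (Cmp C S W B v p) ?x
          \<otimes>\<^bsub>Hom C A B\<^esub> Cmp C A S B (Cmp C S V B v' q) ?x"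
        using o wo sm w w' x by (simp add: comp_add_left comp_closed)
      also have "Cmp C A S B (Cmp C S W B v p) ?x = h"
        using comp_assoc[OF o(1) sm(1) wo(1) o(2) x sm(4) w(3)] p w(4) by simp
      also have "Cmp C A S B (Cmp C S V B v' q) ?x = h'"
        using comp_assoc[OF o(1) sm(1) wo(2) o(2) x sm(5) w'(3)] q w'(4) by simp
      finally show ?thesis .
    qed
    then show ?thesis using factoringI[OF SX x y] by simp
  qed
qed

lemma mem_cls_iff:
  assumes "A \<in> Obj C" "B \<in> Obj C" "g \<in> mor C A B"
  shows "f \<in> cls A B g \<longleftrightarrow> f \<in> mor C A B \<and> cls A B f = cls A B g"
proof -
  have G: "group (Hom C A B)" using assms group_Hom by blast
  have S: "subgroup (factoring C X A B) (Hom C A B)" using assms subgroup_factoring by blast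
  have "f \<in> mor C A B" if "f \<in> cls A B g"
    using that assms(3) G S unfolding quot_class_def
    by (meson monoid.r_coset_subset_G group.is_monoid subgroup.subset subsetD)
  moreover have "cls A B g = cls A B f" if "f \<in> cls A B g"
    using that assms(3) G S unfolding quot_class_def by (meson group.repr_independence)
  moreover have "f \<in> cls A B f" if "f \<in> mor C A B"
    using that G S unfolding quot_class_def by (meson group.rcos_self)
  ultimately show ?thesis by blast
qed

lemma cls_eq_iff_diff:
  assumes "A \<in> Obj C" "B \<in> Obj C" "f \<in> mor C A B" "g \<in> mor C A B"
  shows "cls A B f = cls A B g \<longleftrightarrow> f \<otimes>\<^bsub>Hom C A B\<^esub> inv\<^bsub>Hom C A B\<^esub> g \<in> factoring C X A B"
proof -
  have G: "group (Hom C A B)" using assms group_Hom by blast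
  have S: "subgroup (factoring C X A B) (Hom C A B)" using assms subgroup_factoring by blast
  have "cls A B f = cls A B g \<longleftrightarrow> f \<in> cls A B g"
    using assms by (simp add: mem_cls_iff)
  also have "\<dots> \<longleftrightarrow> f \<otimes>\<^bsub>Hom C A B\<^esub> inv\<^bsub>Hom C A B\<^esub> g \<in> factoring C X A B"
    unfolding quot_class_def using assms G S by (simp add: subgroup.rcos_module)
  finally show ?thesis .
qed

lemma cls_eqE:
  assumes "A \<in> Obj C" "B \<in> Obj C" "f \<in> mor C A B" "g \<in> mor C A B" "cls A B f = cls A B g"
  obtains W u v where "W \<in> X" "u \<in> mor C A W" "v \<in> mor C W B"
    "f = Cmp C A W B v u \<otimes>\<^bsub>Hom C A B\<^esub> g"
proof -
  let ?h = "f \<otimes>\<^bsub>Hom C A B\<^esub> inv\<^bsub>Hom C A B\<^esub> g"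
  have "?h \<in> factoring C X A B" using assms cls_eq_iff_diff by blast
  then obtain W u v where "W \<in> X" "u \<in> mor C A W" "v \<in> mor C W B" "?h = Cmp C A W B v u"
    by (rule factoringE)
  then show ?thesis using that diff_add_cancel[OF assms(1-4)] by simp
qed

lemma cls_add_factoring:
  assumes "A \<in> Obj C" "B \<in> Obj C" "h \<in> factoring C X A B" "g \<in> mor C A B"
  shows "cls A B (h \<otimes>\<^bsub>Hom C A B\<^esub> g) = cls A B g"
proof -
  have h: "h \<in> mor C A B" using assms factoring_closed by blast
  have "(h \<otimes>\<^bsub>Hom C A B\<^esub> g) \<otimes>\<^bsub>Hom C A B\<^esub> inv\<^bsub>Hom C A B\<^esub> g = h"
    using assms h group_Hom[of A B] by (simp add: group.is_monoid monoid.m_assoc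
        group.inv_closed group.r_inv monoid.r_one)
  then show ?thesis using assms h by (simp add: cls_eq_iff_diff add_closed)
qed

lemma Obj_Q [simp]: "Obj Q = Obj C"
  by (simp add: quotient_cat_def)

lemma mor_Q: "mor Q A B = cls A B ` mor C A B"
  by (simp add: quotient_cat_def carrier_FactGroup quot_class_def)

lemma cls_mor: "f \<in> mor C A B \<Longrightarrow> cls A B f \<in> mor Q A B"
  by (simp add: mor_Q)

lemma mor_QE:
  assumes "F \<in> mor Q A B" obtains f where "f \<in> mor C A B" "F = cls A B f"
  using assms by (auto simp: mor_Q)

lemma Idm_Q: "Idm Q A = cls A A (Idm C A)"
  by (simp add: quotient_cat_def)

lemma normal_factoring:
  "\<lbrakk>A \<in> Obj C; B \<in> Obj C\<rbrakk> \<Longrightarrow> factoring C X A B \<lhd> Hom C A B"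
  using subgroup_factoring hom_comm_group comm_group.normal_iff_subgroup by blast

lemma cls_add:
  assumes "A \<in> Obj C" "B \<in> Obj C" "f \<in> mor C A B" "g \<in> mor C A B"
  shows "cls A B f \<otimes>\<^bsub>Hom Q A B\<^esub> cls A B g = cls A B (f \<otimes>\<^bsub>Hom C A B\<^esub> g)"
  using assms normal_factoring by (simp add: quotient_cat_def quot_class_def normal.rcos_sum)

lemma zero_Q:
  assumes "A \<in> Obj C" "B \<in> Obj C"
  shows "zero_mor Q A B = cls A B (zero_mor C A B)"
  using assms subgroup_factoring group_Hom
  by (simp add: quotient_cat_def quot_class_def group.coset_mult_one subgroup.subset)

lemma cls_eq_zero_iff:
  assumes "A \<in> Obj C" "B \<in> Obj C" "f \<in> mor C A B"
  shows "cls A B f = zero_mor Q A B \<longleftrightarrow> f \<in> factoring C X A B"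
  using assms group_Hom by (simp add: zero_Q cls_eq_iff_diff zero_closed
      group.inv_eq_1_iff monoid.inv_one group.is_monoid add_zero)

lemma cls_comp_cong:
  assumes o: "A \<in> Obj C" "B \<in> Obj C" "D \<in> Obj C"
    and f: "f \<in> mor C A B" "f' \<in> mor C A B" "cls A B f = cls A B f'"
    and g: "g \<in> mor C B D" "g' \<in> mor C B D" "cls B D g = cls B D g'"
  shows "cls A D (Cmp C A B D g f) = cls A D (Cmp C A B D g' f')"
proof -
  obtain W u v where w: "W \<in> X" "u \<in> mor C A W" "v \<in> mor C W B"
    "f = Cmp C A W B v u \<otimes>\<^bsub>Hom C A B\<^esub> f'"
    using cls_eqE[OF o(1,2) f] .
  have 1: "Cmp C A W B v u \<in> factoring C X A B" using w factoringI by blast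
  have "Cmp C A B D g f = Cmp C A B D g (Cmp C A W B v u) \<otimes>\<^bsub>Hom C A D\<^esub> Cmp C A B D g f'"
    unfolding w(4) using o f g 1 factoring_closed by (simp add: comp_add_right)
  then have 2: "cls A D (Cmp C A B D g f) = cls A D (Cmp C A B D g f')"
    using o f g 1 by (simp add: cls_add_factoring factoring_postcompose comp_closed)
  obtain V u' v' where w': "V \<in> X" "u' \<in> mor C B V" "v' \<in> mor C V D"
    "g = Cmp C B V D v' u' \<otimes>\<^bsub>Hom C B D\<^esub> g'"
    using cls_eqE[OF o(2,3) g] .
  have 3: "Cmp C B V D v' u' \<in> factoring C X B D" using w' factoringI by blast
  have "Cmp C A B D g f' = Cmp C A B D (Cmp C B V D v' u') f' \<otimes>\<^bsub>Hom C A D\<^esub> Cmp C A B D g' f'"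
    unfolding w'(4) using o f g 3 factoring_closed by (simp add: comp_add_left)
  then have "cls A D (Cmp C A B D g f') = cls A D (Cmp C A B D g' f')"
    using o f g 3 by (simp add: cls_add_factoring factoring_precompose comp_closed)
  with 2 show ?thesis by simp
qed

lemma cls_comp:
  assumes o: "A \<in> Obj C" "B \<in> Obj C" "D \<in> Obj C" and f: "f \<in> mor C A B" and g: "g \<in> mor C B D"
  shows "Cmp Q A B D (cls B D g) (cls A B f) = cls A D (Cmp C A B D g f)"
proof -
  have "Cmp Q A B D (cls B D g) (cls A B f)
      = (\<Union>g' \<in> cls B D g. \<Union>f' \<in> cls A B f. cls A D (Cmp C A B D g' f'))"
    by (simp add: quotient_cat_def)
  also have "\<dots> = (\<Union>g' \<in> cls B D g. \<Union>f' \<in> cls A B f. cls A D (Cmp C A B D g f))"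
    by (intro SUP_cong refl cls_comp_cong) (use o f g mem_cls_iff in auto)
  also have "\<dots> = cls A D (Cmp C A B D g f)"
    using mem_cls_iff[OF o(1,2) f, of f] mem_cls_iff[OF o(2,3) g, of g] f g by auto
  finally show ?thesis .
qed

text \<open>Morphisms to or from an object of \<open>X\<close> factor through it by the identity. So a preenvelope
  becomes a morphism to zero, and pushing it out produces cokernels.\<close>

lemma object_of_X_is_zero_in_Q:
  assumes W: "W \<in> X" shows "is_zero_object Q W"
proof -
  have Wo: "W \<in> Obj C" using W X_obj by blast
  have "(\<exists>!F. F \<in> mor Q W A) \<and> (\<exists>!F. F \<in> mor Q A W)" if A: "A \<in> Obj C" for A
  proof
    have "F = zero_mor Q W A" if "F \<in> mor Q W A" for F
    proof -
      obtain f where f: "f \<in> mor C W A" "F = cls W A f" using \<open>F \<in> mor Q W A\<close> by (rule mor_QE)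
      have "Cmp C W W A f (Idm C W) \<in> factoring C X W A" using f W Wo by (intro factoringI id_closed)
      then show ?thesis using f A Wo by (simp add: cls_eq_zero_iff comp_id_right)
    qed
    moreover have "zero_mor Q W A \<in> mor Q W A" using A Wo zero_Q cls_mor zero_closed by simp
    ultimately show "\<exists>!F. F \<in> mor Q W A" by blast
    have "F = zero_mor Q A W" if "F \<in> mor Q A W" for F
    proof -
      obtain f where f: "f \<in> mor C A W" "F = cls A W f" using \<open>F \<in> mor Q A W\<close> by (rule mor_QE)
      have "Cmp C A W W (Idm C W) f \<in> factoring C X A W" using f W Wo by (intro factoringI id_closed)
      then show ?thesis using f A Wo by (simp add: cls_eq_zero_iff comp_id_left)
    qed
    moreover have "zero_mor Q A W \<in> mor Q A W" using A Wo zero_Q cls_mor zero_closed by simp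
    ultimately show "\<exists>!F. F \<in> mor Q A W" by blast
  qed
  then show ?thesis using Wo by (simp add: is_zero_object_def)
qed

lemma preadditive_category_Q: "preadditive_category Q"
proof (rule preadditive_category.intro, simp_all only: Obj_Q)
  fix A B D F f g h
  assume o: "A \<in> Obj C" "B \<in> Obj C" "D \<in> Obj C" "F \<in> Obj C"
    and m: "f \<in> mor Q A B" "g \<in> mor Q B D" "h \<in> mor Q D F"
  obtain f' where f: "f' \<in> mor C A B" "f = cls A B f'" using m(1) by (rule mor_QE)
  obtain g' where g: "g' \<in> mor C B D" "g = cls B D g'" using m(2) by (rule mor_QE)
  obtain h' where h: "h' \<in> mor C D F" "h = cls D F h'" using m(3) by (rule mor_QE)
  show "Cmp Q A D F h (Cmp Q A B D g f) = Cmp Q A B F (Cmp Q B D F h g) f"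
    using o f g h by (simp add: cls_comp comp_closed comp_assoc)
next
  fix A B D f g
  assume o: "A \<in> Obj C" "B \<in> Obj C" "D \<in> Obj C"
    and m: "f \<in> mor Q A B" "g \<in> mor Q B D"
  obtain f' where f: "f' \<in> mor C A B" "f = cls A B f'" using m(1) by (rule mor_QE)
  obtain g' where g: "g' \<in> mor C B D" "g = cls B D g'" using m(2) by (rule mor_QE)
  show "Cmp Q A B D g f \<in> mor Q A D" using o f g by (simp add: cls_comp comp_closed cls_mor)
  show "Cmp Q A B D (g \<otimes>\<^bsub>Hom Q B D\<^esub> k) f = Cmp Q A B D g f \<otimes>\<^bsub>Hom Q A D\<^esub> Cmp Q A B D k f"
    if "k \<in> mor Q B D" for k
  proof -
    obtain k' where k: "k' \<in> mor C B D" "k = cls B D k'" using \<open>k \<in> mor Q B D\<close> by (rule mor_QE)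
    then show ?thesis using o f g
      by (simp add: cls_comp cls_add comp_closed add_closed comp_add_left)
  qed
  show "Cmp Q A B D g (f \<otimes>\<^bsub>Hom Q A B\<^esub> k) = Cmp Q A B D g f \<otimes>\<^bsub>Hom Q A D\<^esub> Cmp Q A B D g k"
    if "k \<in> mor Q A B" for k
  proof -
    obtain k' where k: "k' \<in> mor C A B" "k = cls A B k'" using \<open>k \<in> mor Q A B\<close> by (rule mor_QE)
    then show ?thesis using o f g
      by (simp add: cls_comp cls_add comp_closed add_closed comp_add_right)
  qed
next
  fix A assume "A \<in> Obj C"
  then show "Idm Q A \<in> mor Q A A" by (simp add: Idm_Q cls_mor id_closed)
next
  fix A B f assume o: "A \<in> Obj C" "B \<in> Obj C" and m: "f \<in> mor Q A B"
  obtain f' where f: "f' \<in> mor C A B" "f = cls A B f'" using m by (rule mor_QE)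
  show "Cmp Q A B B (Idm Q B) f = f" "Cmp Q A A B f (Idm Q A) = f"
    using o f by (simp_all add: Idm_Q cls_comp id_closed comp_id_left comp_id_right)
next
  fix A B assume "A \<in> Obj C" "B \<in> Obj C"
  then show "comm_group (Hom Q A B)"
    by (simp add: quotient_cat_def comm_group.abelian_FactGroup subgroup_factoring hom_comm_group)
qed

lemma additive_category_Q: "additive_category Q"
proof (intro additive_category.intro additive_category_axioms.intro preadditive_category_Q)
  show "\<exists>Z. is_zero_object Q Z"
    using object_of_X_is_zero_in_Q ex_zero_object_in_X by metis
  fix A B assume "A \<in> Obj Q" "B \<in> Obj Q"
  then have o: "A \<in> Obj C" "B \<in> Obj C" by simp_all
  obtain S i j p q where S: "is_biproduct C A B S i j p q" using ex_biproduct o by blast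
  have "is_biproduct Q A B S (cls A S i) (cls B S j) (cls S A p) (cls S B q)"
    using S unfolding is_biproduct_def
    by (simp add: cls_mor cls_comp cls_add zero_Q Idm_Q comp_closed)
  then show "\<exists>S i j p q. is_biproduct Q A B S i j p q" by blast
qed

sublocale Q: additive_category Q
  by (rule additive_category_Q)

end

lemma factoring_op: "factoring (op_cat C) X A B = factoring C X B A"
  unfolding factoring_def op_cat_simps by blast

lemma quot_class_op: "quot_class (op_cat C) X A B f = quot_class C X B A f"
  by (simp add: quot_class_def factoring_op)

lemma quotient_cat_op:
  fixes C :: "('o, 'm) cat"
  shows "quotient_cat (op_cat C) X = op_cat (quotient_cat C X)"
  by (simp add: quotient_cat_def op_cat_def[of "quotient_cat C X"]
      op_cat_def[of "\<lparr>Obj = _, Hom = _, Cmp = _, Idm = _\<rparr>"] factoring_op quot_class_op)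
    (intro ext, blast)

lemma additive_subcategory_op:
  assumes "additive_subcategory C X" shows "additive_subcategory (op_cat C) X"
proof -
  have "B \<in> X" if "A \<in> X" "is_iso C B A f" for A B f
  proof -
    from that(2) obtain g where "is_iso C A B g" unfolding is_iso_def by blast
    then show ?thesis using assms that(1) unfolding additive_subcategory_def by blast
  qed
  then show ?thesis
    using assms unfolding additive_subcategory_def is_iso_op is_zero_object_op is_biproduct_op op_cat_simps
    by blast
qed

lemma (in additive_quotient) additive_quotient_op: "additive_quotient (op_cat C) X"
  by (intro additive_quotient.intro additive_quotient_axioms.intro additive_category_op
      additive_subcategory_op additive_sub)

section \<open>Pushouts in the quotient category\<close>

lemma X_monicE:
  assumes "X_monic C X A B f" "W \<in> X" "w \<in> mor C A W"
  obtains w' where "w' \<in> mor C B W" "Cmp C A B W w' f = w"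
proof -
  have "w \<in> (\<lambda>h. Cmp C A B W h f) ` mor C B W" using assms by (simp add: X_monic_def)
  then show ?thesis using that by blast
qed

lemma X_epicE:
  assumes "X_epic C X A B f" "W \<in> X" "w \<in> mor C W B"
  obtains w' where "w' \<in> mor C W A" "Cmp C W A B f w' = w"
proof -
  have "w \<in> (\<lambda>h. Cmp C W A B f h) ` mor C W A" using assms by (simp add: X_epic_def)
  then show ?thesis using that by blast
qed

locale approximating_subcategory =
  exact_category C E + additive_quotient C X
  for C :: "('o, 'm) cat" and E :: "('o, 'm) short_seq set" and X :: "'o set" +
  assumes ex_precover_conflation:
      "A \<in> Obj C \<Longrightarrow> \<exists>X1 X0 j p. (X1, j, X0, p, A) \<in> E \<and> X_precover C X X0 A p \<and> X1 \<in> X"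
    and ex_preenvelope_conflation:
      "A \<in> Obj C \<Longrightarrow> \<exists>Y0 Y1 i q. (A, i, Y0, q, Y1) \<in> E \<and> X_preenvelope C X A Y0 i \<and> Y1 \<in> X"
begin

abbreviation complete :: "('o, 'm) short_seq set" where
  "complete \<equiv> X_complete_conflations C E X"

abbreviation induced :: "('o, 'm set) short_seq set" where
  "induced \<equiv> induced_conflations C E X"

lemma approximating_subcategory_op: "approximating_subcategory (op_cat C) (op_seqs E) X"
proof (intro approximating_subcategory.intro approximating_subcategory_axioms.intro
    exact_category_op additive_quotient_op)
  fix A assume "A \<in> Obj (op_cat C)"
  then have A: "A \<in> Obj C" by simp
  show "\<exists>X1 X0 j p. (X1, j, X0, p, A) \<in> op_seqs E \<and> X_precover (op_cat C) X X0 A p \<and> X1 \<in> X"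
    using ex_preenvelope_conflation[OF A]
    by (auto simp: X_precover_def X_preenvelope_def X_epic_op)
  show "\<exists>Y0 Y1 i q. (A, i, Y0, q, Y1) \<in> op_seqs E \<and> X_preenvelope (op_cat C) X A Y0 i \<and> Y1 \<in> X"
    using ex_precover_conflation[OF A]
    by (auto simp: X_precover_def X_preenvelope_def X_monic_op)
qed

lemma conflation_kernel: "(A, f, B, g, D) \<in> E \<Longrightarrow> is_kernel C A B D f g"
  and conflation_cokernel: "(A, f, B, g, D) \<in> E \<Longrightarrow> is_cokernel C A B D f g"
  using conflation_kernel_cokernel by (auto simp: kernel_cokernel_pairs_def)

lemma conflation_mor:
  assumes "(A, f, B, g, D) \<in> E"
  shows "A \<in> Obj C" "B \<in> Obj C" "D \<in> Obj C" "f \<in> mor C A B" "g \<in> mor C B D"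
    "Cmp C A B D g f = zero_mor C A D"
  using conflation_kernel[OF assms] by (auto simp: is_kernel_def)

lemma completeD:
  assumes "(A, f, B, g, D) \<in> complete"
  shows "(A, f, B, g, D) \<in> E" "X_monic C X A B f" "X_epic C X B D g"
  using assms by (auto simp: X_complete_conflations_def)

lemma factoring_through_precover:
  assumes o: "A \<in> Obj C" "T \<in> Obj C" and p: "X_precover C X X0 T p" and h: "h \<in> factoring C X A T"
  obtains s where "s \<in> mor C A X0" "Cmp C A X0 T p s = h"
proof -
  have X0: "X0 \<in> Obj C" and e: "X_epic C X X0 T p" and pm: "p \<in> mor C X0 T"
    using p X_obj unfolding X_precover_def X_epic_def by auto
  obtain W u v where w: "W \<in> X" "u \<in> mor C A W" "v \<in> mor C W T" "h = Cmp C A W T v u"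
    using h by (rule factoringE)
  obtain v' where v': "v' \<in> mor C W X0" "Cmp C W X0 T p v' = v"
    using e w(1,3) by (rule X_epicE)
  have "Cmp C A W X0 v' u \<in> mor C A X0" "Cmp C A X0 T p (Cmp C A W X0 v' u) = h"
    using o X0 w v' pm X_obj by (simp_all add: comp_closed comp_assoc)
  then show ?thesis using that by blast
qed

text \<open>Uniqueness of morphisms out of a pushout survives in the quotient. Choose an approximation
  \<open>X1 \<rightarrow> X0 \<rightarrow> T\<close>. If both restrictions of \<open>y\<close> factor through \<open>X\<close>, they lift to \<open>X0\<close>; on
  \<open>A\<close> the two lifts differ by a morphism through \<open>X1\<close>, which extends along the \<open>X\<close>-monic \<open>f\<close>.
  Correcting one lift by that extension makes them glue, and \<open>y\<close> then factors through \<open>X0\<close>.\<close>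

lemma pushout_reflects_factoring:
  assumes P: "is_pushout C A B A' B' f a b f'" and f: "X_monic C X A B f"
    and T: "T \<in> Obj C" and y: "y \<in> mor C B' T"
    and yb: "Cmp C B B' T y b \<in> factoring C X B T" and yf: "Cmp C A' B' T y f' \<in> factoring C X A' T"
  shows "y \<in> factoring C X B' T"
proof -
  have o: "A \<in> Obj C" "B \<in> Obj C" "A' \<in> Obj C" "B' \<in> Obj C"
    "f \<in> mor C A B" "a \<in> mor C A A'" "b \<in> mor C B B'" "f' \<in> mor C A' B'"
    and sq: "Cmp C A B B' b f = Cmp C A A' B' f' a"
    using P by (auto simp: is_pushout_def)
  obtain X1 X0 j p where c: "(X1, j, X0, p, T) \<in> E" and p: "X_precover C X X0 T p" and X1: "X1 \<in> X"
    using ex_precover_conflation[OF T] by blast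
  note cm = conflation_mor[OF c]
  obtain t where t: "t \<in> mor C B X0" "Cmp C B X0 T p t = Cmp C B B' T y b"
    using o(2) T p yb by (rule factoring_through_precover)
  obtain s where s: "s \<in> mor C A' X0" "Cmp C A' X0 T p s = Cmp C A' B' T y f'"
    using o(3) T p yf by (rule factoring_through_precover)
  have "Cmp C A X0 T p (Cmp C A A' X0 s a) = Cmp C A A' T (Cmp C A' B' T y f') a"
    using o cm s by (simp add: comp_assoc)
  also have "\<dots> = Cmp C A B T (Cmp C B B' T y b) f"
    using o T y sq by (simp add: comp_assoc[symmetric])
  also have "\<dots> = Cmp C A X0 T p (Cmp C A B X0 t f)"
    using o cm t by (simp add: comp_assoc)
  finally have ps: "Cmp C A X0 T p (Cmp C A A' X0 s a) = Cmp C A X0 T p (Cmp C A B X0 t f)" .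
  obtain w where w: "w \<in> mor C A X1"
    "Cmp C A A' X0 s a = Cmp C A X1 X0 j w \<otimes>\<^bsub>Hom C A X0\<^esub> Cmp C A B X0 t f"
    by (rule kernel_lift_diff[OF conflation_kernel[OF c] o(1) _ _ ps])
      (use o cm s t comp_closed in auto)
  obtain w' where w': "w' \<in> mor C B X1" "Cmp C A B X1 w' f = w"
    using f X1 w(1) by (rule X_monicE)
  let ?t = "Cmp C B X1 X0 j w' \<otimes>\<^bsub>Hom C B X0\<^esub> t"
  have t': "?t \<in> mor C B X0" using o cm w' t by (simp add: add_closed comp_closed)
  have e: "Cmp C A B X0 ?t f = Cmp C A A' X0 s a"
    using o cm w w' t by (simp add: comp_add_left comp_closed comp_assoc[symmetric])
  obtain z where z: "z \<in> mor C B' X0" "Cmp C B B' X0 z b = ?t" "Cmp C A' B' X0 z f' = s"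
    by (rule pushout_desc[OF P cm(2) t' s(1) e])
  have "Cmp C B X0 T p ?t = Cmp C B X1 T (Cmp C X1 X0 T p j) w' \<otimes>\<^bsub>Hom C B T\<^esub> Cmp C B X0 T p t"
    using o cm w' t by (simp add: comp_add_right comp_closed comp_assoc)
  also have "\<dots> = Cmp C B B' T y b"
    using o cm w' t T y by (simp add: comp_zero_left zero_add comp_closed)
  finally have pt: "Cmp C B X0 T p ?t = Cmp C B B' T y b" .
  have "Cmp C B' X0 T p z = y"
  proof (rule pushout_joint_epi[OF P T _ y])
    show "Cmp C B' X0 T p z \<in> mor C B' T" using o cm z comp_closed by simp
    show "Cmp C B B' T (Cmp C B' X0 T p z) b = Cmp C B B' T y b"
      using o cm z pt by (simp add: comp_assoc[symmetric])
    show "Cmp C A' B' T (Cmp C B' X0 T p z) f' = Cmp C A' B' T y f'"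
      using o cm z s by (simp add: comp_assoc[symmetric])
  qed
  moreover have "X0 \<in> X" using p by (simp add: X_precover_def)
  ultimately show ?thesis using factoringI z(1) cm(5) by blast
qed

text \<open>The central fact: the quotient functor preserves pushouts of \<open>X\<close>-monic morphisms. A square
  that commutes only modulo \<open>X\<close> is made to commute, since the morphism from \<open>A\<close> to an object of
  \<open>X\<close> in its defect extends along \<open>f\<close>; uniqueness is the preceding lemma.\<close>

lemma cls_pushout:
  assumes P: "is_pushout C A B A' B' f a b f'" and f: "X_monic C X A B f"
  shows "is_pushout Q A B A' B' (cls A B f) (cls A A' a) (cls B B' b) (cls A' B' f')"
proof -
  have o: "A \<in> Obj C" "B \<in> Obj C" "A' \<in> Obj C" "B' \<in> Obj C"
    "f \<in> mor C A B" "a \<in> mor C A A'" "b \<in> mor C B B'" "f' \<in> mor C A' B'"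
    and sq: "Cmp C A B B' b f = Cmp C A A' B' f' a"
    using P by (auto simp: is_pushout_def)
  show ?thesis
  proof (rule Q.pushoutI, unfold Obj_Q)
    show "Cmp Q A B B' (cls B B' b) (cls A B f) = Cmp Q A A' B' (cls A' B' f') (cls A A' a)"
      using o sq by (simp add: cls_comp)
    show "\<exists>U \<in> mor Q B' T. Cmp Q B B' T U (cls B B' b) = S \<and> Cmp Q A' B' T U (cls A' B' f') = R"
      if T: "T \<in> Obj C" and S: "S \<in> mor Q B T" and R: "R \<in> mor Q A' T"
        and eq: "Cmp Q A B T S (cls A B f) = Cmp Q A A' T R (cls A A' a)" for T S R
    proof -
      obtain s where s: "s \<in> mor C B T" "S = cls B T s" using S by (rule mor_QE)
      obtain r where r: "r \<in> mor C A' T" "R = cls A' T r" using R by (rule mor_QE)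
      have e: "cls A T (Cmp C A A' T r a) = cls A T (Cmp C A B T s f)"
        using eq s r o T by (simp add: cls_comp)
      obtain W u v where w: "W \<in> X" "u \<in> mor C A W" "v \<in> mor C W T"
        "Cmp C A A' T r a = Cmp C A W T v u \<otimes>\<^bsub>Hom C A T\<^esub> Cmp C A B T s f"
        by (rule cls_eqE[OF o(1) T _ _ e]) (use o T s r comp_closed in auto)
      obtain u' where u': "u' \<in> mor C B W" "Cmp C A B W u' f = u"
        using f w(1,2) by (rule X_monicE)
      have Wo: "W \<in> Obj C" using w X_obj by blast
      let ?h = "Cmp C B W T v u'"
      have h: "?h \<in> factoring C X B T" using w u' factoringI by blast
      have hm: "?h \<in> mor C B T" using h o T factoring_closed by blast
      have e: "Cmp C A B T (?h \<otimes>\<^bsub>Hom C B T\<^esub> s) f = Cmp C A A' T r a"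
        using o T Wo w u' s hm by (simp add: comp_add_left comp_assoc[symmetric])
      obtain y where y: "y \<in> mor C B' T" "Cmp C B B' T y b = ?h \<otimes>\<^bsub>Hom C B T\<^esub> s"
        "Cmp C A' B' T y f' = r"
        by (rule pushout_desc[OF P T _ r(1) e]) (use o T s hm add_closed in auto)
      have "Cmp Q B B' T (cls B' T y) (cls B B' b) = S"
        "Cmp Q A' B' T (cls B' T y) (cls A' B' f') = R"
        using o T y s r h by (simp_all add: cls_comp cls_add_factoring)
      then show ?thesis using cls_mor[OF y(1)] by blast
    qed
    show "U = V" if T: "T \<in> Obj C" and U: "U \<in> mor Q B' T" and V: "V \<in> mor Q B' T"
      and eq: "Cmp Q B B' T U (cls B B' b) = Cmp Q B B' T V (cls B B' b)"
        "Cmp Q A' B' T U (cls A' B' f') = Cmp Q A' B' T V (cls A' B' f')" for T U V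
    proof -
      obtain u where u: "u \<in> mor C B' T" "U = cls B' T u" using U by (rule mor_QE)
      obtain v where v: "v \<in> mor C B' T" "V = cls B' T v" using V by (rule mor_QE)
      let ?y = "u \<otimes>\<^bsub>Hom C B' T\<^esub> inv\<^bsub>Hom C B' T\<^esub> v"
      have "?y \<in> factoring C X B' T"
      proof (rule pushout_reflects_factoring[OF P f T])
        show "?y \<in> mor C B' T" using o T u v by (simp add: add_closed minus_closed)
        have "cls B T (Cmp C B B' T u b) = cls B T (Cmp C B B' T v b)"
          using eq(1) o T u v by (simp add: cls_comp)
        then show "Cmp C B B' T ?y b \<in> factoring C X B T"
          using o T u v by (simp add: comp_add_left comp_minus_left minus_closed
              cls_eq_iff_diff comp_closed)
        have "cls A' T (Cmp C A' B' T u f') = cls A' T (Cmp C A' B' T v f')"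
          using eq(2) o T u v by (simp add: cls_comp)
        then show "Cmp C A' B' T ?y f' \<in> factoring C X A' T"
          using o T u v by (simp add: comp_add_left comp_minus_left minus_closed
              cls_eq_iff_diff comp_closed)
      qed
      then show ?thesis using u v o T cls_eq_iff_diff by blast
    qed
  qed (use o cls_mor in auto)
qed

lemma cls_cokernel_of_X_monic:
  assumes E: "(A, f, B, g, D) \<in> E" and f: "X_monic C X A B f"
  shows "is_cokernel Q A B D (cls A B f) (cls B D g)"
proof -
  obtain Z where Z: "is_zero_object C Z" "Z \<in> X" by (rule ex_zero_object_in_X)
  have "is_pushout C A B Z D f (zero_mor C A Z) g (zero_mor C Z D)"
    by (rule cokernel_is_pushout_along_zero[OF Z(1) conflation_cokernel[OF E]])
  from cls_pushout[OF this f] show ?thesis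
    by (rule Q.pushout_along_zero_is_cokernel[OF object_of_X_is_zero_in_Q[OF Z(2)]])
qed

text \<open>The cokernel of the class of \<open>f\<close> is the pushout of a preenvelope of its domain along \<open>f\<close>,
  because the target of the preenvelope becomes zero.\<close>

lemma ex_cokernel_Q:
  assumes o: "A \<in> Obj C" "B \<in> Obj C" and F: "F \<in> mor Q A B"
  shows "\<exists>D G. is_cokernel Q A B D F G"
proof -
  obtain f where f: "f \<in> mor C A B" "F = cls A B f" using F by (rule mor_QE)
  obtain Y0 Y1 i q where c: "(A, i, Y0, q, Y1) \<in> E" and i: "X_preenvelope C X A Y0 i"
    using ex_preenvelope_conflation[OF o(1)] by blast
  then have iY: "X_monic C X A Y0 i" "Y0 \<in> X" by (auto simp: X_preenvelope_def)
  have "inflation E A Y0 i" using c by (auto simp: inflation_def)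
  then obtain D g y where P: "is_pushout C A Y0 B D i f y g"
    using inflation_pushout o f by blast
  from Q.pushout_sym[OF cls_pushout[OF P iY(1)]]
  have "is_cokernel Q A B D (cls A B f) (cls B D g)"
    by (rule Q.pushout_along_zero_is_cokernel[OF object_of_X_is_zero_in_Q[OF iY(2)]])
  then show ?thesis using f by blast
qed

section \<open>Stability of complete conflations\<close>

lemma complete_id:
  assumes A: "A \<in> Obj C"
  obtains g D where "(A, Idm C A, A, g, D) \<in> complete"
proof -
  obtain g D where c: "(A, Idm C A, A, g, D) \<in> E"
    using inflation_id[OF A] by (auto simp: inflation_def)
  note m = conflation_mor[OF c]
  have g0: "g = zero_mor C A D" using m A by (simp add: comp_id_right)
  have "Idm C D = zero_mor C D D"
    by (rule cokernel_epi[OF conflation_cokernel[OF c] m(3)])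
      (use m g0 in \<open>auto simp: id_closed zero_closed comp_id_left comp_zero_left\<close>)
  then have D0: "w = zero_mor C W D" if "W \<in> Obj C" "w \<in> mor C W D" for W w
    using that m by (metis comp_id_left comp_zero_left)
  have "\<exists>h \<in> mor C W A. Cmp C W A D g h = w" if "W \<in> Obj C" "w \<in> mor C W D" for W w
    using D0[OF that] that A m
    by (intro bexI[of _ "zero_mor C W A"]) (auto simp: zero_closed comp_zero_right)
  then have "X_epic C X A D g"
    unfolding X_epic_def using m comp_closed X_obj by blast
  moreover have "X_monic C X A A (Idm C A)"
    unfolding X_monic_def using m A X_obj by (simp add: comp_id_right)
  ultimately show ?thesis using that c unfolding X_complete_conflations_def by blast
qed

text \<open>\<open>X\<close>-monicity of \<open>f'\<close> is formal. For the deflations, the induced morphism \<open>h\<close> from \<open>D\<close> to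
  \<open>D'\<close> has a right inverse \<open>k\<close>, so a morphism to \<open>D'\<close> can be moved to \<open>D\<close>, lifted along \<open>g\<close>
  and pushed forward along \<open>b\<close>.\<close>

lemma complete_pushout:
  assumes c: "(A, f, B, g, D) \<in> complete" and A': "A' \<in> Obj C" and a: "a \<in> mor C A A'"
  obtains B' f' b g' D' where "is_pushout C A B A' B' f a b f'" "(A', f', B', g', D') \<in> complete"
proof -
  note c = completeD[OF c]
  note m = conflation_mor[OF c(1)]
  have "inflation E A B f" using c by (auto simp: inflation_def)
  then obtain B' f' b where P: "is_pushout C A B A' B' f a b f'" and i: "inflation E A' B' f'"
    using inflation_pushout[OF _ A' a] by blast
  obtain g' D' where c': "(A', f', B', g', D') \<in> E" using i by (auto simp: inflation_def)
  note m' = conflation_mor[OF c']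
  have b: "b \<in> mor C B B'" and sq: "Cmp C A B B' b f = Cmp C A A' B' f' a"
    using P by (auto simp: is_pushout_def)
  have "X_monic C X A' B' f'"
  proof -
    have "\<exists>h \<in> mor C B' W. Cmp C A' B' W h f' = w" if W: "W \<in> X" and w: "w \<in> mor C A' W" for W w
    proof -
      have wa: "Cmp C A A' W w a \<in> mor C A W" using w W X_obj m A' a comp_closed by simp
      obtain t where t: "t \<in> mor C B W" "Cmp C A B W t f = Cmp C A A' W w a"
        using c(2) W wa by (rule X_monicE)
      show ?thesis by (rule pushout_desc[OF P X_obj[OF W] t(1) w t(2)]) blast
    qed
    then show ?thesis unfolding X_monic_def using m' X_obj comp_closed by blast
  qed
  moreover have "X_epic C X B' D' g'"
  proof -
    have "Cmp C A B D' (Cmp C B B' D' g' b) f = Cmp C A B' D' g' (Cmp C A A' B' f' a)"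
      using m m' b sq by (simp add: comp_assoc[symmetric])
    also have "\<dots> = zero_mor C A D'" using m m' a by (simp add: comp_assoc comp_zero_left)
    finally have e: "Cmp C A B D' (Cmp C B B' D' g' b) f = zero_mor C A D'" .
    obtain h where h: "h \<in> mor C D D'" "Cmp C B D D' h g = Cmp C B B' D' g' b"
      by (rule cokernel_factor[OF conflation_cokernel[OF c(1)] m'(3) _ e])
        (use m m' b comp_closed in auto)
    have e: "Cmp C A B D g f = Cmp C A A' D (zero_mor C A' D) a"
      using m A' a comp_zero_left by simp
    \<comment> \<open>the pushout maps to \<open>D\<close> by \<open>g\<close> on \<open>B\<close> and by zero on \<open>A'\<close>\<close>
    obtain k1 where k1: "k1 \<in> mor C B' D" "Cmp C B B' D k1 b = g" "Cmp C A' B' D k1 f' = zero_mor C A' D"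
      by (rule pushout_desc[OF P m(3) m(5) _ e]) (use A' m zero_closed in auto)
    obtain k where k: "k \<in> mor C D' D" "Cmp C B' D' D k g' = k1"
      by (rule cokernel_factor[OF conflation_cokernel[OF c'] m(3) k1(1,3)])
    have "Cmp C B' D D' h k1 = g'"
    proof (rule pushout_joint_epi[OF P m'(3) _ m'(5)])
      show "Cmp C B' D D' h k1 \<in> mor C B' D'" using m m' h k1 comp_closed by simp
      show "Cmp C B B' D' (Cmp C B' D D' h k1) b = Cmp C B B' D' g' b"
        using m m' h k1 b by (simp add: comp_assoc[symmetric])
      show "Cmp C A' B' D' (Cmp C B' D D' h k1) f' = Cmp C A' B' D' g' f'"
        using m m' h k1 by (simp add: comp_assoc[symmetric] comp_zero_right)
    qed
    then have "Cmp C B' D' D' (Cmp C D' D D' h k) g' = Cmp C B' D' D' (Idm C D') g'"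
      using m m' h k by (simp add: comp_assoc[symmetric] comp_id_left)
    then have hk: "Cmp C D' D D' h k = Idm C D'"
      by (rule cokernel_epi[OF conflation_cokernel[OF c'] m'(3), rotated 2])
        (use m m' h k comp_closed id_closed in auto)
    have "\<exists>l \<in> mor C W B'. Cmp C W B' D' g' l = w" if W: "W \<in> X" and w: "w \<in> mor C W D'" for W w
    proof -
      have Wo: "W \<in> Obj C" using W X_obj by blast
      have kw: "Cmp C W D' D k w \<in> mor C W D" using Wo m m' k w comp_closed by simp
      obtain l where l: "l \<in> mor C W B" "Cmp C W B D g l = Cmp C W D' D k w"
        using c(3) W kw by (rule X_epicE)
      have "Cmp C W B' D' g' (Cmp C W B B' b l) = Cmp C W B D' (Cmp C B D D' h g) l"
        using Wo m m' h b l by (simp add: comp_assoc)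
      also have "\<dots> = Cmp C W D D' h (Cmp C W D' D k w)"
        using Wo m m' h(1) l(1) by (simp add: comp_assoc flip: l(2))
      also have "\<dots> = w" using Wo m m' h k w hk by (simp add: iso_cancel_left)
      finally have "Cmp C W B' D' g' (Cmp C W B B' b l) = w" .
      moreover have "Cmp C W B B' b l \<in> mor C W B'" using Wo m m' l b comp_closed by simp
      ultimately show ?thesis by blast
    qed
    then show ?thesis unfolding X_epic_def using m' X_obj comp_closed by blast
  qed
  ultimately show ?thesis using that P c' unfolding X_complete_conflations_def by blast
qed

text \<open>Only \<open>X\<close>-epicity of the cokernel \<open>q\<close> of the composite needs an argument. Since \<open>d\<close> kills
  the composite, \<open>d = e q\<close>; for a test morphism \<open>w\<close> to \<open>S\<close>, lift \<open>e w\<close> through \<open>d\<close> to \<open>w1\<close>. On the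
  pullback of \<open>q\<close> along \<open>w\<close>, the projection \<open>k\<close> to \<open>D\<close> and \<open>w1 \<pi>\<close> agree after \<open>d\<close>, hence differ
  by \<open>g r\<close> for some \<open>r\<close> into \<open>B\<close>. The image of \<open>r\<close> in \<open>B'\<close> descends along the deflation \<open>\<pi>\<close> to
  the domain of \<open>w\<close> and lifts to \<open>w2\<close> there. Now \<open>r\<close> and \<open>w2 \<pi>\<close> differ by something through \<open>f\<close>,
  which dies after \<open>q g\<close>; so \<open>w\<close> and \<open>q (g w2 + w1)\<close> agree after the epimorphism \<open>\<pi>\<close>.\<close>

lemma complete_comp:
  assumes c: "(A, f, B, c, B') \<in> complete" and d: "(B, g, D, d, D') \<in> complete"
  obtains q S where "(A, Cmp C A B D g f, D, q, S) \<in> complete"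
proof -
  note c = completeD[OF c] and d = completeD[OF d]
  note mc = conflation_mor[OF c(1)] and md = conflation_mor[OF d(1)]
  let ?gf = "Cmp C A B D g f"
  have "inflation E A B f" "inflation E B D g" using c d by (auto simp: inflation_def)
  then obtain q S where q: "(A, ?gf, D, q, S) \<in> E"
    using inflation_comp by (meson inflation_def)
  note mq = conflation_mor[OF q]
  have "X_monic C X A D ?gf"
  proof -
    have "\<exists>h \<in> mor C D W. Cmp C A D W h ?gf = w" if W: "W \<in> X" and w: "w \<in> mor C A W" for W w
    proof -
      obtain u where u: "u \<in> mor C B W" "Cmp C A B W u f = w" using c(2) W w by (rule X_monicE)
      obtain v where v: "v \<in> mor C D W" "Cmp C B D W v g = u" using d(2) W u(1) by (rule X_monicE)
      have "Cmp C A D W v ?gf = w" using W X_obj mc md u v by (simp add: comp_assoc)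
      then show ?thesis using v by blast
    qed
    then show ?thesis unfolding X_monic_def using mq X_obj comp_closed by blast
  qed
  moreover have "X_epic C X D S q"
  proof -
    have "Cmp C A D D' d ?gf = zero_mor C A D'"
      using mc md by (simp add: comp_assoc comp_zero_left)
    then obtain e where e: "e \<in> mor C S D'" "Cmp C D S D' e q = d"
      by (rule cokernel_factor[OF conflation_cokernel[OF q] md(3) md(5)])
    have "\<exists>l \<in> mor C W D. Cmp C W D S q l = w" if W: "W \<in> X" and w: "w \<in> mor C W S" for W w
    proof -
      have Wo: "W \<in> Obj C" using W X_obj by blast
      obtain w1 where w1: "w1 \<in> mor C W D" "Cmp C W D D' d w1 = Cmp C W S D' e w"
        by (rule X_epicE[OF d(3) W comp_closed[of W S D' w e]]) (use Wo mq md e w in auto)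
      have "deflation E D S q" using q by (auto simp: deflation_def)
      then obtain P \<pi> k where P: "is_pullback C P D W S k \<pi> q w" and \<pi>: "deflation E P W \<pi>"
        using deflation_pullback Wo w by blast
      obtain J j where j: "(J, j, P, \<pi>, W) \<in> E" using \<pi> by (auto simp: deflation_def)
      note mj = conflation_mor[OF j]
      have k: "k \<in> mor C P D" "Cmp C P D S q k = Cmp C P W S w \<pi>"
        using P by (auto simp: is_pullback_def)
      have "Cmp C P D D' d k = Cmp C P S D' e (Cmp C P D S q k)"
        using mq md mj e k(1) by (simp add: comp_assoc)
      also have "\<dots> = Cmp C P D D' d (Cmp C P W D w1 \<pi>)"
        using mq md mj e k Wo w w1 by (simp add: comp_assoc)
      finally have dk: "Cmp C P D D' d k = Cmp C P D D' d (Cmp C P W D w1 \<pi>)" .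
      obtain r where r: "r \<in> mor C P B"
        "k = Cmp C P B D g r \<otimes>\<^bsub>Hom C P D\<^esub> Cmp C P W D w1 \<pi>"
        by (rule kernel_lift_diff[OF conflation_kernel[OF d(1)] mj(2) k(1) _ dk])
          (use mj md w1 Wo comp_closed in auto)
      have kj: "Cmp C J P D k j = Cmp C J B D g (Cmp C J P B r j)"
        unfolding r(2) using mj md w1 Wo r(1)
        by (simp add: comp_add_left comp_closed comp_assoc[symmetric] comp_zero_right add_zero)
      have "Cmp C J D S q (Cmp C J P D k j) = Cmp C J P S (Cmp C P W S w \<pi>) j"
        using mj mq k by (simp add: comp_assoc)
      also have "\<dots> = zero_mor C J S"
        using mj mq w Wo by (simp add: comp_assoc[symmetric] comp_zero_right)
      finally have qkj: "Cmp C J D S q (Cmp C J P D k j) = zero_mor C J S" .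
      obtain n where n: "n \<in> mor C J A" "Cmp C J A D ?gf n = Cmp C J P D k j"
        by (rule kernel_lift[OF conflation_kernel[OF q] mj(1) _ qkj])
          (use mj md k comp_closed in auto)
      have "Cmp C J B D g (Cmp C J A B f n) = Cmp C J B D g (Cmp C J P B r j)"
        using n kj mj mc md by (simp add: comp_assoc)
      then have fn: "Cmp C J A B f n = Cmp C J P B r j"
        by (rule kernel_mono[OF conflation_kernel[OF d(1)] mj(1), rotated 2])
          (use mj mc n r comp_closed in auto)
      have "Cmp C J P B' (Cmp C P B B' c r) j = Cmp C J B B' c (Cmp C J A B f n)"
        unfolding fn using mj mc r(1) by (simp add: comp_assoc)
      also have "\<dots> = zero_mor C J B'"
        using mj mc n by (simp add: comp_assoc comp_zero_left)
      finally have cr: "Cmp C J P B' (Cmp C P B B' c r) j = zero_mor C J B'" .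
      obtain h where h: "h \<in> mor C W B'" "Cmp C P W B' h \<pi> = Cmp C P B B' c r"
        by (rule cokernel_factor[OF conflation_cokernel[OF j] mc(3) _ cr])
          (use mj mc r comp_closed in auto)
      obtain w2 where w2: "w2 \<in> mor C W B" "Cmp C W B B' c w2 = h"
        using c(3) W h(1) by (rule X_epicE)
      have cr': "Cmp C P B B' c r = Cmp C P B B' c (Cmp C P W B w2 \<pi>)"
        using h w2 mj mc Wo by (simp add: comp_assoc)
      obtain z where z: "z \<in> mor C P A" "r = Cmp C P A B f z \<otimes>\<^bsub>Hom C P B\<^esub> Cmp C P W B w2 \<pi>"
        by (rule kernel_lift_diff[OF conflation_kernel[OF c(1)] mj(2) r(1) _ cr'])
          (use mj mc w2 Wo comp_closed in auto)
      let ?l = "Cmp C W B D g w2 \<otimes>\<^bsub>Hom C W D\<^esub> w1"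
      have l: "?l \<in> mor C W D" using Wo md w1 w2 by (simp add: add_closed comp_closed)
      have "Cmp C P B D g r = Cmp C P A D ?gf z \<otimes>\<^bsub>Hom C P D\<^esub> Cmp C P W D (Cmp C W B D g w2) \<pi>"
        unfolding z(2) using z(1) mj mc md w2 Wo by (simp add: comp_add_right comp_closed comp_assoc)
      then have "Cmp C P D S q (Cmp C P B D g r) = Cmp C P W S (Cmp C W D S q (Cmp C W B D g w2)) \<pi>"
        using z(1) mj mc md mq w2 Wo
        by (simp add: comp_add_right comp_closed comp_assoc comp_zero_left zero_add)
      then have "Cmp C P D S q k = Cmp C P W S (Cmp C W D S q ?l) \<pi>"
        unfolding r(2) using r(1) mj md mq w1 w2 Wo
        by (simp add: comp_add_right comp_add_left comp_closed comp_assoc)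
      then have "Cmp C P W S w \<pi> = Cmp C P W S (Cmp C W D S q ?l) \<pi>" using k by simp
      then have "w = Cmp C W D S q ?l"
        by (rule cokernel_epi[OF conflation_cokernel[OF j] mq(3) w, rotated])
          (use mq l Wo comp_closed in auto)
      then show ?thesis using l by blast
    qed
    then show ?thesis unfolding X_epic_def using mq X_obj comp_closed by blast
  qed
  ultimately show ?thesis using that q unfolding X_complete_conflations_def by blast
qed

section \<open>The induced exact structure\<close>

lemma induced_op: "induced_conflations (op_cat C) (op_seqs E) X = op_seqs induced"
proof -
  have "(A, F, B, G, D) \<in> induced_conflations (op_cat C) (op_seqs E) X
      \<longleftrightarrow> (D, G, B, F, A) \<in> induced" for A F B G D
    unfolding induced_conflations_def mem_Collect_eq X_complete_conflations_op mem_op_seqs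
      quotient_cat_op quot_class_op Q.seq_isomorphic_op
    by blast
  then show ?thesis by auto
qed

lemma complete_mor:
  assumes "(A, f, B, g, D) \<in> complete"
  shows "A \<in> Obj C" "B \<in> Obj C" "D \<in> Obj C" "f \<in> mor C A B" "g \<in> mor C B D"
  using conflation_mor[OF completeD(1)[OF assms]] by auto

lemma inducedE:
  assumes "(A, F, B, G, D) \<in> induced"
  obtains A' f B' g D' where "(A', f, B', g, D') \<in> complete"
    "seq_isomorphic Q (A, F, B, G, D) (A', cls A' B' f, B', cls B' D' g, D')"
  using assms unfolding induced_conflations_def by blast

lemma induced_cokernel: "(A, F, B, G, D) \<in> induced \<Longrightarrow> is_cokernel Q A B D F G"
  using Q.cokernel_transport cls_cokernel_of_X_monic completeD by (metis inducedE)

lemma induced_iso_closed: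
  assumes "s \<in> induced" "seq_isomorphic Q s t" shows "t \<in> induced"
  using assms Q.seq_isomorphic_trans Q.seq_isomorphic_sym unfolding induced_conflations_def by blast

text \<open>Being an inflation of the induced structure is a property of the isomorphism class of the
  arrow alone, as the second morphism of the sequence can be transported.\<close>

lemma inflation_inducedI:
  assumes c: "(A', f, B', g, D) \<in> complete" and F: "F \<in> mor Q A B"
    and a: "is_iso Q A A' a" and b: "is_iso Q B B' b"
    and sq: "Cmp Q A B B' b F = Cmp Q A A' B' (cls A' B' f) a"
  shows "inflation induced A B F"
proof -
  note m = complete_mor[OF c]
  let ?G = "Cmp Q B B' D (cls B' D g) b"
  have D: "is_iso Q D D (Idm Q D)" using m Q.iso_id by simp
  have G: "?G \<in> mor Q B D" using Q.isoD[OF b] m cls_mor Q.comp_closed by simp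
  have "Cmp Q B D D (Idm Q D) ?G = ?G" using Q.isoD[OF b] m G by (simp add: Q.comp_id_left)
  then have "seq_isomorphic Q (A, F, B, ?G, D) (A', cls A' B' f, B', cls B' D g, D)"
    unfolding seq_isomorphic_def using F G m cls_mor a b D sq by blast
  then have "(A, F, B, ?G, D) \<in> induced" using c unfolding induced_conflations_def by blast
  then show ?thesis unfolding inflation_def by blast
qed

lemma inflation_inducedE:
  assumes "inflation induced A B F"
  obtains A' f B' g D a b where "(A', f, B', g, D) \<in> complete" "F \<in> mor Q A B"
    "is_iso Q A A' a" "is_iso Q B B' b" "Cmp Q A B B' b F = Cmp Q A A' B' (cls A' B' f) a"
proof -
  obtain G D where "(A, F, B, G, D) \<in> induced" using assms unfolding inflation_def by blast
  then obtain A' f B' g D' where "(A', f, B', g, D') \<in> complete"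
    "seq_isomorphic Q (A, F, B, G, D) (A', cls A' B' f, B', cls B' D' g, D')" by (rule inducedE)
  then show ?thesis using that unfolding seq_isomorphic_def by blast
qed

lemma complete_inflation_induced:
  assumes "(A, f, B, g, D) \<in> complete" shows "inflation induced A B (cls A B f)"
proof -
  note m = complete_mor[OF assms]
  show ?thesis
    by (rule inflation_inducedI[OF assms _ Q.iso_id Q.iso_id])
      (use m cls_mor in \<open>auto simp: Q.comp_id_left Q.comp_id_right\<close>)
qed

lemma induced_inflation_id: "A \<in> Obj C \<Longrightarrow> inflation induced A A (Idm Q A)"
  using complete_id complete_inflation_induced unfolding Idm_Q by metis

lemma induced_inflation_pushout:
  assumes F: "inflation induced A B F" and A': "A' \<in> Obj C" and H: "H \<in> mor Q A A'"
  shows "\<exists>B' F' K. is_pushout Q A B A' B' F H K F' \<and> inflation induced A' B' F'"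
proof -
  obtain A1 f B1 g D a b where c: "(A1, f, B1, g, D) \<in> complete" and Fm: "F \<in> mor Q A B"
    and a: "is_iso Q A A1 a" and b: "is_iso Q B B1 b"
    and sq: "Cmp Q A B B1 b F = Cmp Q A A1 B1 (cls A1 B1 f) a"
    using F by (rule inflation_inducedE)
  note m = complete_mor[OF c]
  obtain a' where a': "is_iso Q A1 A a'" "Cmp Q A A1 A a' a = Idm Q A"
    by (rule Q.iso_inverse[OF a])
  have am: "A \<in> Obj C" "a \<in> mor Q A A1" "a' \<in> mor Q A1 A"
    using Q.isoD[OF a] Q.isoD[OF a'(1)] by auto
  have "Cmp Q A1 A A' H a' \<in> mor Q A1 A'" using H A' am m Q.comp_closed by simp
  then obtain h where h: "h \<in> mor C A1 A'" "Cmp Q A1 A A' H a' = cls A1 A' h" by (rule mor_QE)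
  obtain B' f' k g' D' where P: "is_pushout C A1 B1 A' B' f h k f'"
    and c': "(A', f', B', g', D') \<in> complete"
    using c A' h(1) by (rule complete_pushout)
  have "is_pushout Q A B A' B' F (Cmp Q A A1 A' (cls A1 A' h) a)
      (Cmp Q B B1 B' (cls B1 B' k) b) (cls A' B' f')"
    by (rule Q.pushout_of_isomorphic_arrow[OF cls_pushout[OF P completeD(2)[OF c]] a b Fm sq])
  moreover have "Cmp Q A A1 A' (cls A1 A' h) a = H"
    using H A' am m a'(2) by (simp add: Q.iso_cancel_right flip: h(2))
  ultimately show ?thesis using complete_inflation_induced[OF c'] by auto
qed

text \<open>Composable inflations are represented by complete conflations starting with \<open>A1 \<rightarrow> B1\<close> and
  \<open>B2 \<rightarrow> D2\<close>, where \<open>B1\<close> and \<open>B2\<close> need only be isomorphic in the quotient, so the representatives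
  do not compose. Pushing the second one out along a representative of that isomorphism replaces
  it by a complete conflation starting with \<open>B1 \<rightarrow> D3\<close>; in the quotient this is a pushout along
  an isomorphism, so \<open>D2\<close> and \<open>D3\<close> are isomorphic there.\<close>

lemma induced_inflation_comp:
  assumes F: "inflation induced A B F" and G: "inflation induced B D G"
  shows "inflation induced A D (Cmp Q A B D G F)"
proof -
  obtain A1 f B1 g S1 a b where c: "(A1, f, B1, g, S1) \<in> complete" and Fm: "F \<in> mor Q A B"
    and a: "is_iso Q A A1 a" and b: "is_iso Q B B1 b"
    and sq: "Cmp Q A B B1 b F = Cmp Q A A1 B1 (cls A1 B1 f) a"
    using F by (rule inflation_inducedE)
  obtain B2 f2 D2 g2 S2 b2 d where c2: "(B2, f2, D2, g2, S2) \<in> complete" and Gm: "G \<in> mor Q B D"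
    and b2: "is_iso Q B B2 b2" and d: "is_iso Q D D2 d"
    and sq2: "Cmp Q B D D2 d G = Cmp Q B B2 D2 (cls B2 D2 f2) b2"
    using G by (rule inflation_inducedE)
  note m = complete_mor[OF c] and m2 = complete_mor[OF c2]
  obtain b' where b': "is_iso Q B2 B b'" "Cmp Q B B2 B b' b2 = Idm Q B"
    by (rule Q.iso_inverse[OF b2])
  have i: "is_iso Q B2 B1 (Cmp Q B2 B B1 b b')" using b'(1) b by (rule Q.iso_comp)
  note im = Q.isoD[OF a] Q.isoD[OF b] Q.isoD[OF b2] Q.isoD[OF d] Q.isoD[OF b'(1)] Q.isoD[OF i]
  then obtain h where h: "h \<in> mor C B2 B1" "Cmp Q B2 B B1 b b' = cls B2 B1 h"
    using mor_QE by blast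
  obtain D3 f3 k g3 S3 where P: "is_pushout C B2 D2 B1 D3 f2 h k f3"
    and c3: "(B1, f3, D3, g3, S3) \<in> complete"
    using c2 m(2) h(1) by (rule complete_pushout)
  note m3 = complete_mor[OF c3]
  have PQ: "is_pushout Q B2 D2 B1 D3 (cls B2 D2 f2) (cls B2 B1 h) (cls D2 D3 k) (cls B1 D3 f3)"
    using cls_pushout[OF P completeD(2)[OF c2]] .
  then have k: "is_iso Q D2 D3 (cls D2 D3 k)"
    using Q.pushout_of_iso i unfolding h(2) by blast
  have e: "Cmp Q B2 D2 D3 (cls D2 D3 k) (cls B2 D2 f2) = Cmp Q B2 B1 D3 (cls B1 D3 f3) (cls B2 B1 h)"
    using PQ by (simp add: is_pushout_def)
  have hb: "Cmp Q B B2 B1 (cls B2 B1 h) b2 = b"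
    using im m b'(2) by (simp add: Q.iso_cancel_right flip: h(2))
  have 1: "Cmp Q B D D3 (Cmp Q D D2 D3 (cls D2 D3 k) d) G = Cmp Q B B1 D3 (cls B1 D3 f3) b"
    using Q.square_paste[of B D B2 D2 B1 D3 G "cls B2 D2 f2" "cls B1 D3 f3" b2 d "cls B2 B1 h" "cls D2 D3 k"]
      im m m2 m3 Gm sq2 e hb h(1) Q.isoD[OF k] cls_mor by simp
  obtain q S where cc: "(A1, Cmp C A1 B1 D3 f3 f, D3, q, S) \<in> complete"
    using c c3 by (rule complete_comp)
  show ?thesis
  proof (rule inflation_inducedI[OF cc _ a Q.iso_comp[OF d k]])
    show "Cmp Q A B D G F \<in> mor Q A D" using im Fm Gm Q.comp_closed by simp
    have kd: "Cmp Q D D2 D3 (cls D2 D3 k) d \<in> mor Q D D3"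
      using Q.isoD[OF Q.iso_comp[OF d k]] by simp
    have f: "cls A1 B1 f \<in> mor Q A1 B1" "cls B1 D3 f3 \<in> mor Q B1 D3" using m m3 cls_mor by auto
    have "Cmp Q A D D3 (Cmp Q D D2 D3 (cls D2 D3 k) d) (Cmp Q A B D G F)
        = Cmp Q A B D3 (Cmp Q B B1 D3 (cls B1 D3 f3) b) F"
      using im m3 Fm Gm kd by (simp add: Q.comp_assoc 1)
    also have "\<dots> = Cmp Q A B1 D3 (cls B1 D3 f3) (Cmp Q A A1 B1 (cls A1 B1 f) a)"
      using im m3 Fm f by (simp add: Q.comp_assoc[symmetric] sq)
    also have "\<dots> = Cmp Q A A1 D3 (Cmp Q A1 B1 D3 (cls B1 D3 f3) (cls A1 B1 f)) a"
      using im m m3 f by (simp add: Q.comp_assoc)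
    also have "Cmp Q A1 B1 D3 (cls B1 D3 f3) (cls A1 B1 f) = cls A1 D3 (Cmp C A1 B1 D3 f3 f)"
      using m m3 by (simp add: cls_comp)
    finally show "Cmp Q A D D3 (Cmp Q D D2 D3 (cls D2 D3 k) d) (Cmp Q A B D G F)
        = Cmp Q A A1 D3 (cls A1 D3 (Cmp C A1 B1 D3 f3 f)) a" .
  qed
qed

theorem preabelian_Q: "preabelian_category Q"
proof -
  interpret op: approximating_subcategory "op_cat C" "op_seqs E" X
    by (rule approximating_subcategory_op)
  show ?thesis
  proof
    fix A B F assume o: "A \<in> Obj Q" "B \<in> Obj Q" "F \<in> mor Q A B"
    show "\<exists>D G. is_cokernel Q A B D F G" using ex_cokernel_Q o by simp
    show "\<exists>K k. is_kernel Q K A B k F"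
      using op.ex_cokernel_Q[of B A F] o by (simp add: quotient_cat_op is_cokernel_op)
  qed
qed

theorem exact_Q: "exact_category Q induced"
proof -
  interpret op: approximating_subcategory "op_cat C" "op_seqs E" X
    by (rule approximating_subcategory_op)
  have op: "quotient_cat (op_cat C) X = op_cat Q"
    "induced_conflations (op_cat C) (op_seqs E) X = op_seqs induced"
    using quotient_cat_op induced_op by auto
  show ?thesis
  proof
    have "is_kernel Q A B D F G" if "(A, F, B, G, D) \<in> induced" for A F B G D
      using op.induced_cokernel[of D G B F A] that by (simp add: op is_cokernel_op)
    then show "induced \<subseteq> kernel_cokernel_pairs Q"
      using induced_cokernel by (auto simp: kernel_cokernel_pairs_def)
    show "t \<in> induced" if "s \<in> induced" "seq_isomorphic Q s t" for s t
      using induced_iso_closed that .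
    show "inflation induced A A (Idm Q A)" if "A \<in> Obj Q" for A
      using induced_inflation_id that by simp
    show "deflation induced A A (Idm Q A)" if "A \<in> Obj Q" for A
      using op.induced_inflation_id[of A] that by (simp add: op inflation_op)
    show "inflation induced A D (Cmp Q A B D g f)"
      if "inflation induced A B f" "inflation induced B D g" for A B D f g
      using induced_inflation_comp that .
    show "deflation induced A D (Cmp Q A B D g f)"
      if "deflation induced A B f" "deflation induced B D g" for A B D f g
      using op.induced_inflation_comp[of D B g A f] that by (simp add: op inflation_op)
    show "\<exists>B' f' b. is_pushout Q A B A' B' f a b f' \<and> inflation induced A' B' f'"
      if "inflation induced A B f" "A' \<in> Obj Q" "a \<in> mor Q A A'" for A B f A' a
      using induced_inflation_pushout that by simp
    show "\<exists>B' g' b. is_pullback Q B' B D' D b g' g d \<and> deflation induced B' D' g'"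
      if "deflation induced B D g" "D' \<in> Obj Q" "d \<in> mor Q D' D" for B D g D' d
      using op.induced_inflation_pushout[of D B g D' d] that
      by (auto simp: op inflation_op is_pushout_op)
  qed
qed

end

theorem theorem5p1:
  fixes C :: "('o, 'm) cat" and E :: "('o, 'm) short_seq set" and X :: "'o set"
  assumes "exact_category C E"
    and "additive_subcategory C X"
    and "\<And>A. A \<in> Obj C \<Longrightarrow>
           \<exists>X1 X0 j p. (X1, j, X0, p, A) \<in> E \<and> X_precover C X X0 A p \<and> X1 \<in> X"
    and "\<And>A. A \<in> Obj C \<Longrightarrow>
           \<exists>Y0 Y1 i q. (A, i, Y0, q, Y1) \<in> E \<and> X_preenvelope C X A Y0 i \<and> Y1 \<in> X"
  shows "preabelian_category (quotient_cat C X) \<and>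
         exact_category (quotient_cat C X) (induced_conflations C E X)"
proof -
  interpret exact_category C E by (rule assms(1))
  interpret approximating_subcategory C E X
    using assms(2-4) by unfold_locales
  show ?thesis using preabelian_Q exact_Q by blast
qed

end
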